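(* Let $d\ge2$ and let $A\subset\mathbb{R}^d$ be a nonempty bounded set. For any real $\underline{\alpha}<\underline{\dim}_B(A)$ and every $z\in\mathbb{R}$, $$\lim_{n\to\infty}\mathbb{P}\bigl(\mathcal{T}(nA)-\underline{\alpha}\log n\le z\bigr)=0 .$$ Furthermore, for any real $\overline{\alpha}>\overline{\dim}_B(A)$ and every $z\in\mathbb{R}$, $$\lim_{n\to\infty}\mathbb{P}\bigl(\mathcal{T}(nA)-\overline{\alpha}\log n\le z\bigr)=1 .$$ Here $nA=\{nx:x\in A\}$.
   Context: Fix $d\ge 2$. Let $A(d,1)$ be the set of all (infinite) lines in $\mathbb{R}^d$, and let $B(x,\rho)$ be the closed ball of radius $\rho$ centred at $x$; $o$ is the origin. Let $\mu_{d,1}$ be the unique (locally finite Borel) measure on $A(d,1)$ invariant under rotations, reflections and translations, normalized so that $\mu_{d,1}(\{L\in A(d,1):L\cap B(o,1)\ne\emptyset\})=1$. Let $\Psi$ be a Poisson point process on $A(d,1)\times\mathbb{R}^+$ with intensity measure $\mu_{d,1}\times\lambda_1^+$, where $\lambda_1^+$ is Lebesgue measure on $\mathbb{R}^+$. For a line $L$ let $\mathfrak{c}(L)=\{x\in\mathbb{R}^d:d(x,L)\le 1\}$ ($d(\cdot,\cdot)$ is Euclidean distance). The cover time of a set $A\subset\mathbb{R}^d$ is $$\mathcal{T}(A)=\inf\Bigl\{t>0:A\subset\bigcup_{(L,s)\in\Psi:\,s\le t}\mathfrak{c}(L)\Bigr\}.$$ For bounded $A\subset\mathbb{R}^d$ and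 $\delta>0$, $N_\delta(A)$ is the minimum number of boxes of side length $\delta$ needed to cover $A$. The upper and lower box dimensions are $$\overline{\dim}_B(A)=\limsup_{\delta\to0}\frac{\log N_\delta(A)}{-\log\delta},\qquad \underline{\dim}_B(A)=\liminf_{\delta\to0}\frac{\log N_\delta(A)}{-\log\delta}.$$ *)

theory Defs
  imports "HOL-Probability.Probability"
begin

section \<open>The space of lines\<close>

definition lines :: "(real^'d) set set" where
  "lines = {L. affine L \<and> aff_dim L = 1}"

definition line_through :: "real^'d \<Rightarrow> real^'d \<Rightarrow> (real^'d) set" where
  "line_through x v = range (\<lambda>t. x + t *\<^sub>R v)"

text \<open>The usual topology on the affine Grassmannian of lines: the quotient topology of
  \<open>(x, v) \<mapsto> line_through x v\<close> on pairs with \<open>v \<noteq> 0\<close>.\<close>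

definition line_topology :: "(real^'d) set topology" where
  "line_topology = topology (\<lambda>U. U \<subseteq> lines \<and> open {(x, v). v \<noteq> 0 \<and> line_through x v \<in> U})"

lemma openin_line_topology:
  "openin line_topology U \<longleftrightarrow> U \<subseteq> lines \<and> open {(x, v). v \<noteq> 0 \<and> line_through x v \<in> U}"
proof -
  have "istopology (\<lambda>U::(real^'d) set set.
      U \<subseteq> lines \<and> open {(x, v). v \<noteq> 0 \<and> line_through x v \<in> U})" (is "istopology ?P")
    unfolding istopology_def
  proof (intro conjI allI impI)
    fix S T :: "(real^'d) set set"
    assume S: "?P S" and T: "?P T"
    then show "S \<inter> T \<subseteq> lines" by blast
    have "{(x, v). v \<noteq> 0 \<and> line_through x v \<in> S \<inter> T} =
        {(x, v). v \<noteq> 0 \<and> line_through x v \<in> S} \<inter> {(x, v). v \<noteq> 0 \<and> line_through x v \<in> T}"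
      by blast
    then show "open {(x, v). v \<noteq> 0 \<and> line_through x v \<in> S \<inter> T}"
      using S T by (simp only: open_Int)
  next
    fix \<K> :: "(real^'d) set set set"
    assume K: "\<forall>S\<in>\<K>. ?P S"
    then show "\<Union>\<K> \<subseteq> lines" by blast
    have "{(x, v). v \<noteq> 0 \<and> line_through x v \<in> \<Union>\<K>} =
        (\<Union>S\<in>\<K>. {(x, v). v \<noteq> 0 \<and> line_through x v \<in> S})"
      by blast
    then show "open {(x, v). v \<noteq> 0 \<and> line_through x v \<in> \<Union>\<K>}"
      using K by (simp only:) blast
  qed
  then show ?thesis
    unfolding line_topology_def by (subst topology_inverse') auto
qed

lemma line_through_in_lines:
  assumes "v \<noteq> 0"
  shows "line_through x v \<in> lines"
proof -
  have *: "line_through x v = affine hull {x, x + v}"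
  proof (intro subset_antisym subsetI)
    fix y assume "y \<in> line_through x v"
    then obtain t where "y = x + t *\<^sub>R v"
      by (auto simp: line_through_def)
    then have "y = (1 - t) *\<^sub>R x + t *\<^sub>R (x + v)"
      by (simp add: algebra_simps)
    then show "y \<in> affine hull {x, x + v}"
      unfolding affine_hull_2 by (smt (verit) mem_Collect_eq)
  next
    fix y assume "y \<in> affine hull {x, x + v}"
    then obtain u w :: real where uw: "u + w = 1" and y: "y = u *\<^sub>R x + w *\<^sub>R (x + v)"
      unfolding affine_hull_2 by auto
    have "y = (u + w) *\<^sub>R x + w *\<^sub>R v"
      unfolding y by (simp add: algebra_simps)
    with uw show "y \<in> line_through x v"
      by (auto simp: line_through_def)
  qed
  show ?thesis
    using assms by (simp add: lines_def * aff_dim_2 affine_affine_hull)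
qed

lemma topspace_line_topology: "topspace (line_topology :: (real^'d) set topology) = lines"
proof -
  have "{(x, v). v \<noteq> 0 \<and> line_through x v \<in> lines} = UNIV \<times> - {0 :: real^'d}"
    using line_through_in_lines by auto
  then have "openin line_topology (lines :: (real^'d) set set)"
    by (simp add: openin_line_topology open_Times open_Compl)
  then show ?thesis
    by (metis openin_line_topology openin_subset openin_topspace subset_antisym)
qed

text \<open>The motion invariant measure on the lines, normalised on the lines that meet the
  unit ball. Local finiteness means finiteness on compact sets of lines; orthogonal
  transformations are both the rotations and the reflections.\<close>

definition invariant_line_measure :: "(real^'d) set measure \<Rightarrow> bool" where
  "invariant_line_measure \<mu> \<longleftrightarrow>
     space \<mu> = lines \<and>
     sets \<mu> = sigma_sets lines {U. openin line_topology U} \<and>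
     (\<forall>K. compactin line_topology K \<longrightarrow> emeasure \<mu> K < \<infinity>) \<and>
     (\<forall>Q. orthogonal_transformation Q \<longrightarrow>
        (\<forall>S\<in>sets \<mu>. emeasure \<mu> ((\<lambda>L. Q ` L) ` S) = emeasure \<mu> S)) \<and>
     (\<forall>b. \<forall>S\<in>sets \<mu>. emeasure \<mu> ((\<lambda>L. (+) b ` L) ` S) = emeasure \<mu> S) \<and>
     emeasure \<mu> {L\<in>lines. L \<inter> cball 0 1 \<noteq> {}} = 1"

section \<open>Poisson point processes\<close>

text \<open>A point process on the topological space \<open>X\<close> is given by its random locally finite set
  of points. This loses nothing for the diffuse intensity measures \<open>\<Lambda>\<close> used here, for which
  multiple points do not occur almost surely. Local finiteness is required for every
  outcome. The library's \<open>poisson_pmf\<close> needs a positive rate, hence the explicit formula,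
  in which \<open>0 ^ 0 = 1\<close>.\<close>

definition count_in :: "'e set \<Rightarrow> 'e set \<Rightarrow> ennreal" where
  "count_in \<psi> B = emeasure (count_space UNIV) (\<psi> \<inter> B)"

definition poisson_point_process ::
    "'w measure \<Rightarrow> 'e topology \<Rightarrow> 'e measure \<Rightarrow> ('w \<Rightarrow> 'e set) \<Rightarrow> bool" where
  "poisson_point_process M X \<Lambda> \<Psi> \<longleftrightarrow>
     prob_space M \<and>
     (\<forall>\<omega>\<in>space M. \<Psi> \<omega> \<subseteq> topspace X \<and> (\<forall>K. compactin X K \<longrightarrow> finite (\<Psi> \<omega> \<inter> K))) \<and>
     (\<forall>B\<in>sets \<Lambda>. (\<lambda>\<omega>. count_in (\<Psi> \<omega>) B) \<in> borel_measurable M) \<and>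
     (\<forall>B\<in>sets \<Lambda>. emeasure \<Lambda> B < \<infinity> \<longrightarrow>
        (\<forall>k::nat. measure M {\<omega>\<in>space M. count_in (\<Psi> \<omega>) B = of_nat k} =
           exp (- measure \<Lambda> B) * measure \<Lambda> B ^ k / fact k)) \<and>
     (\<forall>B\<in>sets \<Lambda>. emeasure \<Lambda> B = \<infinity> \<longrightarrow> (AE \<omega> in M. count_in (\<Psi> \<omega>) B = \<infinity>)) \<and>
     (\<forall>(m::nat) B. (\<forall>i<m. B i \<in> sets \<Lambda>) \<longrightarrow> disjoint_family_on B {..<m} \<longrightarrow>
        prob_space.indep_vars M (\<lambda>_. borel) (\<lambda>i \<omega>. count_in (\<Psi> \<omega>) (B i)) {..<m})"

text \<open>The time axis is the closed half-line, so that a locally finite process has only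
  finitely many points in a compact set of lines up to each time.\<close>

definition poisson_line_process ::
    "'w measure \<Rightarrow> (real^'d) set measure \<Rightarrow> ('w \<Rightarrow> ((real^'d) set \<times> real) set) \<Rightarrow> bool" where
  "poisson_line_process M \<mu> \<Psi> \<longleftrightarrow>
     poisson_point_process M (prod_topology line_topology (top_of_set {0..}))
       (\<mu> \<Otimes>\<^sub>M restrict_space lborel {0..}) \<Psi>"

section \<open>Cover times\<close>

definition cylinder :: "(real^'d) set \<Rightarrow> (real^'d) set" where
  "cylinder L = {x. infdist x L \<le> 1}"

definition cover_time :: "((real^'d) set \<times> real) set \<Rightarrow> (real^'d) set \<Rightarrow> ereal" where
  "cover_time \<psi> A =
     Inf {ereal t | t. 0 < t \<and> A \<subseteq> (\<Union>(L, s)\<in>{(L, s)\<in>\<psi>. s \<le> t}. cylinder L)}"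

section \<open>Box dimensions\<close>

text \<open>Boxes are closed axis-parallel cubes in arbitrary position, indexed by their lower corners.\<close>

definition box_number :: "real \<Rightarrow> (real^'d) set \<Rightarrow> nat" where
  "box_number \<delta> A =
     (LEAST k. \<exists>C. finite C \<and> card C = k \<and> A \<subseteq> (\<Union>x\<in>C. cbox x (x + (\<chi> i. \<delta>))))"

definition upper_box_dim :: "(real^'d) set \<Rightarrow> ereal" where
  "upper_box_dim A = Limsup (at_right 0) (\<lambda>\<delta>. ereal (ln (real (box_number \<delta> A)) / - ln \<delta>))"

definition lower_box_dim :: "(real^'d) set \<Rightarrow> ereal" where
  "lower_box_dim A = Liminf (at_right 0) (\<lambda>\<delta>. ereal (ln (real (box_number \<delta> A)) / - ln \<delta>))"

end

(*
Lower bound. Pick points of nA at mutual distance at least D = n^e; their number is governed by the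
lower box dimension. The events that two of
these points are uncovered at time t are positively correlated only through the lines that hit both
unit balls, which have measure O(1/D) by a rotation argument. Since log n / D tends to 0, the second
moment method yields an uncovered point.

Upper bound. Cover nA by boxes of small fixed size; their number is governed by the upper box
dimension. A line at distance at most rho < 1 from the corner of a small box covers the whole box,
so a union bound over the boxes suffices as soon as the measure of the lines hitting the ball of
radius rho is close to 1. This continuity at rho = 1 amounts to the tangent lines of the unit sphere
having measure 0.
*)

theory Submission
  imports Defs
begin

section \<open>Distances to lines\<close>

text \<open>The measure is accessible only through its invariance, its normalisation and its
  finiteness on compact sets; no formula in direction and offset is at hand. Both estimates on it
  are therefore packing arguments: many congruent copies of a set of lines, with bounded overlap,
  fit into one set of finite measure. Each limit then spends the gap between \<open>\<alpha>\<close>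
  and the dimension. In the lower bound, an exponent l in the gap gives about n^(l(1-e)) points at
  spacing n^e, each uncovered with probability of order n^(-\<alpha>). So e must be small enough for
  l(1-e) > \<alpha>, while any e > 0 makes the correlations negligible. In the upper bound, about
  n^u boxes face the probability n^(-\<alpha> f), where f is the measure of the lines hitting a ball
  of radius rho; so rho must be close enough to 1 for f > u/\<alpha>.\<close>

lemma lines_eq_line_through:
  assumes "L \<in> lines" "p \<in> L"
  obtains v where "norm v = 1" "L = line_through p v"
proof -
  from assms(1) have L: "affine L" "aff_dim L = 1"
    by (auto simp: lines_def)
  have "L \<noteq> {p}"
    using L(2) by auto
  with assms(2) obtain q where q: "q \<in> L" "q \<noteq> p"
    by blast
  define v where "v = (1 / norm (q - p)) *\<^sub>R (q - p)"
  have v1: "norm v = 1"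
    using q by (simp add: v_def)
  have sub: "line_through p v \<subseteq> L"
  proof
    fix y assume "y \<in> line_through p v"
    then obtain t where "y = p + t *\<^sub>R v"
      by (auto simp: line_through_def)
    then have "y = (1 - t / norm (q - p)) *\<^sub>R p + (t / norm (q - p)) *\<^sub>R q"
      by (simp add: v_def algebra_simps)
    then show "y \<in> L"
      using L(1) q assms(2) by (auto simp: affine_def)
  qed
  have "line_through p v \<in> lines"
    using v1 line_through_in_lines[of v p] by force
  then have "aff_dim (line_through p v) = 1" "affine (line_through p v)"
    by (auto simp: lines_def)
  then have "line_through p v = L"
    using sub L affine_dim_equal[of "line_through p v" L] by (auto simp: line_through_def)
  with v1 that show ?thesis
    by blast
qed

lemma lines_nonempty: "L \<in> lines \<Longrightarrow> L \<noteq> {}"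
  by (auto simp: lines_def)

text \<open>The nearest point is the orthogonal projection. The direction is any nonzero vector,
  because openness of a set of lines is tested on all such pairs.\<close>

lemma infdist_line_through:
  fixes x y v :: "real^'d"
  assumes "v \<noteq> 0"
  shows "infdist x (line_through y v) = norm (x - y - ((x - y) \<bullet> v / (v \<bullet> v)) *\<^sub>R v)"
proof -
  define w where "w = x - y"
  define c where "c = w \<bullet> v / (v \<bullet> v)"
  have vv: "v \<bullet> v \<noteq> 0"
    using assms by simp
  have orth: "(w - c *\<^sub>R v) \<bullet> v = 0"
    using vv by (simp add: c_def inner_diff_left)
  have le: "norm (w - c *\<^sub>R v) \<le> dist x a" if "a \<in> line_through y v" for a
  proof -
    from that obtain t where a: "a = y + t *\<^sub>R v"
      by (auto simp: line_through_def)
    have "x - a = (w - c *\<^sub>R v) + (c - t) *\<^sub>R v"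
      by (simp add: a w_def algebra_simps)
    moreover have "orthogonal (w - c *\<^sub>R v) ((c - t) *\<^sub>R v)"
      using orth by (simp add: orthogonal_def)
    ultimately have "(norm (x - a))\<^sup>2 = (norm (w - c *\<^sub>R v))\<^sup>2 + (norm ((c - t) *\<^sub>R v))\<^sup>2"
      by (simp add: norm_add_Pythagorean)
    then have "(norm (w - c *\<^sub>R v))\<^sup>2 \<le> (norm (x - a))\<^sup>2"
      by simp
    then show ?thesis
      by (metis dist_norm norm_ge_zero power2_le_imp_le)
  qed
  have ne: "line_through y v \<noteq> {}"
    by (auto simp: line_through_def)
  have "y + c *\<^sub>R v \<in> line_through y v"
    by (auto simp: line_through_def)
  then have "infdist x (line_through y v) \<le> dist x (y + c *\<^sub>R v)"
    by (rule infdist_le)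
  also have "\<dots> = norm (w - c *\<^sub>R v)"
    by (simp add: dist_norm w_def algebra_simps)
  finally have "infdist x (line_through y v) \<le> norm (w - c *\<^sub>R v)" .
  moreover have "norm (w - c *\<^sub>R v) \<le> infdist x (line_through y v)"
    unfolding infdist_notempty[OF ne] using le ne by (intro cINF_greatest) auto
  ultimately show ?thesis
    by (simp add: w_def c_def)
qed

lemma infdist_line_through_unit:
  fixes x y v :: "real^'d"
  assumes "norm v = 1"
  shows "(infdist x (line_through y v))\<^sup>2 = (norm (x - y))\<^sup>2 - ((x - y) \<bullet> v)\<^sup>2"
proof -
  have v: "v \<noteq> 0" "v \<bullet> v = 1"
    using assms by (auto simp: dot_square_norm)
  show ?thesis
    unfolding infdist_line_through[OF v(1)] v(2)
    unfolding power2_norm_eq_inner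
    by (simp add: inner_diff_left inner_diff_right v(2) inner_commute power2_eq_square)
qed

lemma infdist_line_attained:
  fixes L :: "(real^'d) set"
  assumes "L \<in> lines"
  obtains p where "p \<in> L" "infdist x L = dist x p"
proof -
  have "closed L"
    using assms by (auto simp: lines_def affine_closed)
  then show ?thesis
    using infdist_attains_inf[of L x] lines_nonempty[OF assms] that by blast
qed

lemma infdist_isometry_image:
  assumes "\<And>u v. dist (f u) (f v) = dist u v"
  shows "infdist (f x) (f ` S) = infdist x S"
  by (simp add: infdist_def image_image assms)

section \<open>Lines that hit a ball\<close>

text \<open>Dual to \<open>cylinder\<close>: for a line \<open>L\<close>,
  \<open>x \<in> cylinder L\<close> holds iff \<open>L \<in> hit x 1\<close>. The form by
  \<open>infdist\<close> makes it a sublevel set of a continuous function of the line.\<close>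

definition hit :: "real^'d \<Rightarrow> real \<Rightarrow> (real^'d) set set" where
  "hit x r = {L \<in> lines. infdist x L \<le> r}"

lemma hit_mono: "r \<le> s \<Longrightarrow> hit x r \<subseteq> hit x s"
  by (auto simp: hit_def)

lemma infdist_translate_bound:
  assumes "infdist x L \<le> r" "dist x y \<le> s"
  shows "infdist y L \<le> r + s"
  using infdist_triangle[of y L x] assms by (simp add: dist_commute)

lemma hit_shift: "dist x y \<le> s \<Longrightarrow> hit x r \<subseteq> hit y (r + s)"
  by (auto simp: hit_def intro: infdist_translate_bound)

text \<open>The predicate \<open>P\<close> stays abstract so that lines hitting a ball and lines
  tangent to it are transported alike.\<close>

lemma image_lines_infdist:
  fixes f g :: "real^'d \<Rightarrow> real^'d"
  assumes dist: "\<And>u v. dist (f u) (f v) = dist u v"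
    and lines: "\<And>L. L \<in> lines \<Longrightarrow> f ` L \<in> lines" "\<And>L. L \<in> lines \<Longrightarrow> g ` L \<in> lines"
    and inv: "\<And>u. f (g u) = u"
  shows "(`) f ` {L \<in> lines. P (infdist x L)} = {L \<in> lines. P (infdist (f x) L)}"
proof (intro subset_antisym subsetI)
  fix L assume "L \<in> (`) f ` {L \<in> lines. P (infdist x L)}"
  then show "L \<in> {L \<in> lines. P (infdist (f x) L)}"
    using lines(1) by (auto simp: infdist_isometry_image[OF dist])
next
  fix L assume L: "L \<in> {L \<in> lines. P (infdist (f x) L)}"
  have eq: "L = f ` (g ` L)"
    by (simp add: image_image inv)
  have "infdist x (g ` L) = infdist (f x) (f ` (g ` L))"
    by (rule infdist_isometry_image[OF dist, symmetric])
  with L lines(2) have "g ` L \<in> {L \<in> lines. P (infdist x L)}"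
    by (simp flip: eq)
  with eq show "L \<in> (`) f ` {L \<in> lines. P (infdist x L)}"
    by blast
qed

lemma translation_lines: "L \<in> lines \<Longrightarrow> (+) b ` L \<in> lines"
  by (auto simp: lines_def affine_translation[symmetric] aff_dim_translation_eq)

lemma orthogonal_lines:
  fixes L :: "(real^'d) set"
  assumes "orthogonal_transformation Q" "L \<in> lines"
  shows "Q ` L \<in> lines"
proof -
  have Q: "linear Q" "inj Q"
    using assms(1) by (simp_all add: orthogonal_transformation_linear orthogonal_transformation_inj)
  have "Q ` (affine hull L) = affine hull (Q ` L)"
    using Q(1) by (intro affine_hull_linear_image) (simp add: linear_conv_bounded_linear)
  moreover have "affine hull L = L"
    using assms(2) by (simp add: lines_def affine_hull_eq)
  ultimately have "affine (Q ` L)"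
    by (metis affine_affine_hull)
  then show ?thesis
    using assms(2) Q by (simp add: lines_def)
qed

lemma image_translation_lines:
  "(`) ((+) b) ` {L \<in> lines. P (infdist x L)} = {L \<in> lines. P (infdist (b + x) L)}"
proof (rule image_lines_infdist[where g = "(+) (- b)"])
  show "(+) (- b) ` L \<in> lines" if "L \<in> lines" for L
    using that by (rule translation_lines)
qed (auto intro: translation_lines)

lemma image_orthogonal_lines:
  fixes Q :: "real^'d \<Rightarrow> real^'d"
  assumes "orthogonal_transformation Q"
  shows "(`) Q ` {L \<in> lines. P (infdist x L)} = {L \<in> lines. P (infdist (Q x) L)}"
proof (rule image_lines_infdist[where g = "inv Q"])
  show "dist (Q u) (Q v) = dist u v" for u v
    using assms by (simp add: orthogonal_transformation_isometry)
  show "Q (inv Q u) = u" for u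
    using assms by (meson orthogonal_transformation_surj surj_f_inv_f)
qed (use assms in \<open>auto intro: orthogonal_lines orthogonal_transformation_inv\<close>)

section \<open>Topology of the space of lines\<close>

text \<open>In a quotient topology it suffices to test continuity on the pairs (y, v), where the
  projection formula is visibly continuous. Measurability of the sets of lines used below rests on
  this.\<close>

lemma continuous_map_infdist_lines:
  fixes x :: "real^'d"
  shows "continuous_map line_topology euclideanreal (infdist x)"
proof -
  have "openin line_topology {L \<in> topspace line_topology. infdist x L \<in> U}" if "open U" for U
  proof -
    let ?g = "\<lambda>(y, v). norm (x - y - ((x - y) \<bullet> v / (v \<bullet> v)) *\<^sub>R v)"
    have "continuous_on (UNIV \<times> - {0}) ?g"
      by (auto simp: split_beta intro!: continuous_intros)
    moreover have "open (UNIV \<times> - {0 :: real^'d} :: ((real^'d) \<times> (real^'d)) set)"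
      by (intro open_Times) auto
    ultimately have "open (?g -` U \<inter> (UNIV \<times> - {0}))"
      using \<open>open U\<close> continuous_on_open_vimage by blast
    moreover have "?g -` U \<inter> (UNIV \<times> - {0}) =
        {(y, v). v \<noteq> 0 \<and> line_through y v \<in> {L \<in> lines. infdist x L \<in> U}}"
      by (auto simp: infdist_line_through line_through_in_lines)
    ultimately show ?thesis
      by (auto simp: openin_line_topology topspace_line_topology)
  qed
  then show ?thesis
    by (simp add: continuous_map_def)
qed

text \<open>These lines are the image of base points in the ball and unit directions, a compact set;
  the base point is the point of the line nearest to \<open>x\<close>. Hence the measure of the set
  is finite, and finitely many process points fall in it up to any time.\<close>

lemma compactin_hit:
  fixes x :: "real^'d"
  shows "compactin line_topology (hit x r)"
proof -
  have "continuous_map (top_of_set (UNIV \<times> - {0})) line_topology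
      (\<lambda>(y :: real^'d, v). line_through y v)"
    unfolding continuous_map_def
  proof (intro conjI allI impI)
    show "(\<lambda>(y :: real^'d, v). line_through y v) \<in>
        topspace (top_of_set (UNIV \<times> - {0})) \<rightarrow> topspace line_topology"
      by (auto simp: topspace_line_topology intro!: line_through_in_lines)
  next
    fix U :: "(real^'d) set set" assume "openin line_topology U"
    then have o: "open {(y, v). v \<noteq> 0 \<and> line_through y v \<in> U}"
      by (simp add: openin_line_topology)
    have "{p \<in> topspace (top_of_set (UNIV \<times> - {0})). (\<lambda>(y, v). line_through y v) p \<in> U} =
        (UNIV \<times> - {0}) \<inter> {(y, v). v \<noteq> 0 \<and> line_through y v \<in> U}"
      by auto
    then show "openin (top_of_set (UNIV \<times> - {0}))
        {p \<in> topspace (top_of_set (UNIV \<times> - {0})). (\<lambda>(y, v). line_through y v) p \<in> U}"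
      by (simp only:) (rule openin_open_Int[OF o])
  qed
  moreover have "compact (cball x r \<times> sphere (0 :: real^'d) 1)"
    by (intro compact_Times) auto
  then have "compactin (top_of_set (UNIV \<times> - {0})) (cball x r \<times> sphere (0 :: real^'d) 1)"
    by (auto simp: compactin_subtopology)
  ultimately have "compactin line_topology
      ((\<lambda>(y, v). line_through y v) ` (cball x r \<times> sphere (0 :: real^'d) 1))"
    by (rule image_compactin[rotated])
  moreover have "(\<lambda>(y, v). line_through y v) ` (cball x r \<times> sphere (0 :: real^'d) 1) = hit x r"
  proof (intro subset_antisym subsetI)
    fix L assume "L \<in> (\<lambda>(y, v). line_through y v) ` (cball x r \<times> sphere (0 :: real^'d) 1)"
    then obtain y v where L: "L = line_through y v" "dist x y \<le> r" "norm v = 1"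
      by auto
    then have "y \<in> L" "L \<in> lines"
      using line_through_in_lines[of v y] by (force simp: line_through_def)+
    then show "L \<in> hit x r"
      using L(2) infdist_le2[of y L x r] by (auto simp: hit_def)
  next
    fix L assume "L \<in> hit x r"
    then have L: "L \<in> lines" "infdist x L \<le> r"
      by (auto simp: hit_def)
    then obtain p where p: "p \<in> L" "infdist x L = dist x p"
      using infdist_line_attained by blast
    then obtain v where "norm v = 1" "L = line_through p v"
      using L(1) lines_eq_line_through by blast
    with p L show "L \<in> (\<lambda>(y, v). line_through y v) ` (cball x r \<times> sphere (0 :: real^'d) 1)"
      by force
  qed
  ultimately show ?thesis
    by simp
qed

section \<open>Measures of sets of lines\<close>

text \<open>Centres on a straight line would not do: a parallel line at distance 1 is tangent to all
  the balls. Along a parabola the squared distance to a fixed line is a polynomial of degree at most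
  4 in \<open>s\<close>, and it is never constantly 1.\<close>

lemma card_line_tangencies:
  fixes L :: "(real^'d) set"
  assumes L: "L \<in> lines" and ab: "a \<noteq> b" and "finite S"
  shows "card {s \<in> S. infdist (s *\<^sub>R axis a 1 + s\<^sup>2 *\<^sub>R axis b 1) L = 1} \<le> 4"
proof -
  obtain y where y: "y \<in> L"
    using lines_nonempty[OF L] by blast
  then obtain v where v: "norm v = 1" "L = line_through y v"
    using lines_eq_line_through[OF L] by blast
  \<comment> \<open>With p(s) the point of the parabola, \<open>q\<close> is |p(s) - y|^2 - ((p(s) -
    y) . v)^2 - 1 expanded in powers of s.\<close>
  define c where "c = y \<bullet> v"
  define q where "q = [: (norm y)\<^sup>2 - c\<^sup>2 - 1, - 2 * y $ a + 2 * c * v $ a,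
      1 - 2 * y $ b - (v $ a)\<^sup>2 + 2 * c * v $ b, - 2 * v $ a * v $ b, 1 - (v $ b)\<^sup>2 :]"
  have nab: "axis a (1::real) $ b = 0" "axis b (1::real) $ a = 0"
    using ab by (auto simp: axis_def)
  have root: "poly q s = 0" if "infdist (s *\<^sub>R axis a 1 + s\<^sup>2 *\<^sub>R axis b 1) L = 1" for s
  proof -
    let ?p = "s *\<^sub>R axis a 1 + s\<^sup>2 *\<^sub>R axis b 1 :: real^'d"
    have "(norm (?p - y))\<^sup>2 - ((?p - y) \<bullet> v)\<^sup>2 = 1"
      using that infdist_line_through_unit[OF v(1), of ?p y] v(2) by simp
    moreover have "(norm (?p - y))\<^sup>2 = s\<^sup>2 + s^4 - 2 * (s * y $ a + s\<^sup>2 * y $ b) + (norm y)\<^sup>2"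
      unfolding power2_norm_eq_inner
      by (simp add: inner_add_left inner_add_right inner_diff_left inner_diff_right nab
          inner_axis' inner_axis algebra_simps) (simp add: power2_eq_square power4_eq_xxxx)
    moreover have "(?p - y) \<bullet> v = s * v $ a + s\<^sup>2 * v $ b - c"
      by (simp add: inner_add_left inner_diff_left inner_axis' c_def)
    ultimately have "s\<^sup>2 + s^4 - 2 * (s * y $ a + s\<^sup>2 * y $ b) + (norm y)\<^sup>2
        - (s * v $ a + s\<^sup>2 * v $ b - c)\<^sup>2 = 1"
      by simp
    then show ?thesis
      by (simp add: q_def power2_eq_square power4_eq_xxxx algebra_simps)
  qed
  \<comment> \<open>A vanishing leading coefficient forces v to be plus or minus the axis
    \<open>b\<close>. Then \<open>c * v $ b = y $ b\<close>, and the quadratic coefficient is 1, not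
    0.\<close>
  have "q \<noteq> 0"
  proof
    assume "q = 0"
    then have e: "(v $ b)\<^sup>2 = 1" "1 - 2 * y $ b - (v $ a)\<^sup>2 + 2 * c * v $ b = 0" "v $ a * v $ b = 0"
      by (auto simp: q_def)
    then have va: "v $ a = 0"
      by auto
    have "(norm (v - v $ b *\<^sub>R axis b 1))\<^sup>2 = (norm v)\<^sup>2 - (v $ b)\<^sup>2"
      unfolding power2_norm_eq_inner
      by (simp add: inner_diff_left inner_diff_right inner_axis inner_axis' power2_eq_square)
    then have "v = v $ b *\<^sub>R axis b 1"
      using v(1) e(1) by simp
    then have "c = v $ b * y $ b"
      unfolding c_def by (metis inner_axis inner_real_def inner_scaleR_right mult.right_neutral)
    then have "c * v $ b = y $ b"
      using e(1) by (simp add: power2_eq_square)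
    with e(2) va show False
      by simp
  qed
  moreover have "degree q \<le> 4"
    unfolding q_def by (intro order_trans[OF degree_pCons_le]) (simp add: degree_pCons_eq_if)
  ultimately have "card {s. poly q s = 0} \<le> 4" "finite {s. poly q s = 0}"
    using card_poly_roots_bound[of q] poly_roots_finite[of q] by auto
  moreover have "{s \<in> S. infdist (s *\<^sub>R axis a 1 + s\<^sup>2 *\<^sub>R axis b 1) L = 1} \<subseteq> {s. poly q s = 0}"
    using root by auto
  ultimately show ?thesis
    by (meson card_mono order_trans)
qed

locale invariant_lines =
  fixes \<mu> :: "(real^'d) set measure"
  assumes dim_ge_2: "CARD('d) \<ge> 2"
    and invariant: "invariant_line_measure \<mu>"
begin

lemma space_mu: "space \<mu> = lines"
  and sets_mu: "sets \<mu> = sigma_sets lines {U. openin line_topology U}"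
  and finite_mu_compact: "compactin line_topology K \<Longrightarrow> emeasure \<mu> K < \<infinity>"
  and mu_orthogonal: "orthogonal_transformation Q \<Longrightarrow> S \<in> sets \<mu> \<Longrightarrow>
      emeasure \<mu> ((`) Q ` S) = emeasure \<mu> S"
  and mu_translation: "S \<in> sets \<mu> \<Longrightarrow> emeasure \<mu> ((`) ((+) b) ` S) = emeasure \<mu> S"
  and mu_unit_ball: "emeasure \<mu> {L \<in> lines. L \<inter> cball 0 1 \<noteq> {}} = 1"
  using invariant by (auto simp: invariant_line_measure_def)

text \<open>Here d \<ge> 2 enters: the parabola and the rotated ball centres lie in the plane of
  these two axes.\<close>

lemma obtain_axes: obtains a b :: 'd where "a \<noteq> b"
proof -
  obtain a :: 'd where True by simp
  have "\<not> (UNIV :: 'd set) \<subseteq> {a}"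
  proof
    assume "(UNIV :: 'd set) \<subseteq> {a}"
    then have "CARD('d) \<le> card {a}"
      by (intro card_mono) auto
    with dim_ge_2 show False
      by simp
  qed
  then show ?thesis
    using that by blast
qed

lemma measurable_infdist [measurable]: "infdist x \<in> borel_measurable \<mu>"
proof (rule borel_measurableI)
  fix U :: "real set" assume "open U"
  then have "openin line_topology {L \<in> topspace line_topology. infdist x L \<in> U}"
    using continuous_map_infdist_lines[of x] by (simp add: continuous_map_def)
  then show "infdist x -` U \<inter> space \<mu> \<in> sets \<mu>"
    unfolding sets_mu
    by (intro sigma_sets.Basic) (simp add: space_mu topspace_line_topology vimage_def Int_def conj_commute)
qed

lemma sets_lines_infdist:
  assumes [measurable]: "Measurable.pred borel P"
  shows "{L \<in> lines. P (infdist x L)} \<in> sets \<mu>"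
proof -
  have "{L \<in> space \<mu>. P (infdist x L)} \<in> sets \<mu>"
    by measurable
  then show ?thesis
    by (simp add: space_mu)
qed

lemma sets_hit [measurable, intro, simp]: "hit x r \<in> sets \<mu>"
  unfolding hit_def by (rule sets_lines_infdist) measurable

lemma emeasure_hit_finite: "emeasure \<mu> (hit x r) < \<infinity>"
  by (rule finite_mu_compact[OF compactin_hit])

lemma fmeasurable_hit [intro, simp]: "hit x r \<in> fmeasurable \<mu>"
  using emeasure_hit_finite by (intro fmeasurableI) auto

lemma emeasure_lines_infdist_eq:
  assumes "Measurable.pred borel P"
  shows "emeasure \<mu> {L \<in> lines. P (infdist x L)} = emeasure \<mu> {L \<in> lines. P (infdist 0 L)}"
  using mu_translation[OF sets_lines_infdist[OF assms, of 0], of x]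
  by (simp add: image_translation_lines)

lemma emeasure_hit_eq: "emeasure \<mu> (hit x r) = emeasure \<mu> (hit 0 r)"
  unfolding hit_def by (rule emeasure_lines_infdist_eq) measurable

lemma hit_0_1: "(hit 0 1 :: (real^'d) set set) = {L \<in> lines. L \<inter> cball 0 1 \<noteq> {}}"
proof -
  have "infdist 0 L \<le> 1 \<longleftrightarrow> L \<inter> cball 0 1 \<noteq> {}" if L: "L \<in> lines" for L :: "(real^'d) set"
  proof
    assume le: "infdist 0 L \<le> 1"
    obtain p where "p \<in> L" "infdist 0 L = dist 0 p"
      using infdist_line_attained[OF L] by blast
    with le show "L \<inter> cball 0 1 \<noteq> {}"
      by auto
  next
    assume "L \<inter> cball 0 1 \<noteq> {}"
    then obtain p where "p \<in> L" "dist 0 p \<le> 1"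
      by auto
    then show "infdist 0 L \<le> 1"
      by (rule infdist_le2)
  qed
  then show ?thesis
    by (auto simp: hit_def)
qed

lemma emeasure_hit_1: "emeasure \<mu> (hit x 1) = 1"
  using emeasure_hit_eq[of x 1] mu_unit_ball by (simp add: hit_0_1)

lemma measure_hit_1: "measure \<mu> (hit x 1) = 1"
  by (simp add: measure_def emeasure_hit_1)

text \<open>Unit balls centred on a parabola: a line is tangent to at most four of them, since
  tangency is a quartic equation for the parameter.\<close>

lemma emeasure_tangent_lines: "emeasure \<mu> {L \<in> lines. infdist x L = 1} = 0"
proof -
  obtain a b :: 'd where ab: "a \<noteq> b"
    by (rule obtain_axes)
  define T where "T x = {L \<in> lines. infdist x L = 1}" for x :: "real^'d"
  define p where "p s = s *\<^sub>R axis a 1 + s\<^sup>2 *\<^sub>R axis b (1::real)" for s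
  have T_sets: "T y \<in> sets \<mu>" for y
    unfolding T_def by (rule sets_lines_infdist) measurable
  have T_eq: "emeasure \<mu> (T y) = emeasure \<mu> (T x)" for y
    using emeasure_lines_infdist_eq[of "\<lambda>t. t = 1" y] emeasure_lines_infdist_eq[of "\<lambda>t. t = 1" x]
    by (simp add: T_def)
  \<comment> \<open>The k sets of tangent lines have equal measure and cover each line at most four
    times. For s in [0,1] the centre has norm at most 2, so its tangent lines come within 3 of the
    origin.\<close>
  have bound: "of_nat k * emeasure \<mu> (T x) \<le> 4 * emeasure \<mu> (hit 0 3)" for k
  proof -
    define S where "S = (\<lambda>i. real i / real k) ` {..<k}"
    have S: "finite S" "card S = k"
      unfolding S_def by (auto intro!: card_image[THEN trans] inj_onI)
    have S01: "s \<in> {0..1}" if "s \<in> S" for s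
      using that by (auto simp: S_def)
    have le: "(\<Sum>s\<in>S. indicator (T (p s)) L) \<le> (4 * indicator (hit 0 3) L :: ennreal)"
      if "L \<in> space \<mu>" for L
    proof (cases "L \<in> hit 0 3")
      case True
      have "(\<Sum>s\<in>S. indicator (T (p s)) L :: ennreal) = (\<Sum>s\<in>{s\<in>S. infdist (p s) L = 1}. 1)"
        using S(1) that
        by (intro sum.mono_neutral_cong_right) (auto simp: T_def space_mu indicator_def)
      also have "\<dots> = of_nat (card {s \<in> S. infdist (p s) L = 1})"
        by simp
      also have "\<dots> \<le> of_nat 4"
        using card_line_tangencies[OF _ ab S(1), of L] that by (simp only: of_nat_le_iff p_def space_mu)
      finally show ?thesis
        using True by simp
    next
      case False
      have "indicator (T (p s)) L = (0::ennreal)" if s: "s \<in> S" for s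
      proof -
        have "norm (p s) \<le> \<bar>s\<bar> + \<bar>s\<^sup>2\<bar>"
          unfolding p_def by (rule order_trans[OF norm_triangle_ineq]) simp
        also have "\<dots> \<le> 1 + 1"
          using S01[OF s] by (intro add_mono) (auto simp: power_le_one)
        finally have "dist (p s) 0 \<le> 2"
          by simp
        from hit_shift[OF this, of 1] False show ?thesis
          by (auto simp: T_def hit_def indicator_def)
      qed
      then show ?thesis
        by simp
    qed
    have "of_nat k * emeasure \<mu> (T x) = (\<Sum>s\<in>S. emeasure \<mu> (T (p s)))"
      by (simp add: T_eq[of "p _"] S(2))
    also have "\<dots> = (\<Sum>s\<in>S. \<integral>\<^sup>+L. indicator (T (p s)) L \<partial>\<mu>)"
      using T_sets by simp
    also have "\<dots> = (\<integral>\<^sup>+L. (\<Sum>s\<in>S. indicator (T (p s)) L) \<partial>\<mu>)"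
      using T_sets by (intro nn_integral_sum[symmetric]) auto
    also have "\<dots> \<le> (\<integral>\<^sup>+L. 4 * indicator (hit 0 3) L \<partial>\<mu>)"
      using le by (rule nn_integral_mono)
    also have "\<dots> = 4 * emeasure \<mu> (hit 0 3)"
      by (simp add: nn_integral_cmult)
    finally show ?thesis .
  qed
  \<comment> \<open>One copy already gives finiteness, which permits the passage to real numbers,
    where letting k grow forces the value 0.\<close>
  have fin: "emeasure \<mu> (T x) < \<infinity>"
    using bound[of 1] emeasure_hit_finite[of 0 3]
    by (simp add: ennreal_mult_less_top order_le_less_trans)
  define t where "t = measure \<mu> (T x)"
  define h where "h = measure \<mu> (hit 0 3)"
  have "real k * t \<le> 4 * h" for k
  proof -
    have "ennreal (real k * t) \<le> ennreal (4 * h)"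
      using bound[of k] fin emeasure_hit_finite[of 0 3]
      by (simp add: t_def h_def ennreal_mult emeasure_eq_ennreal_measure ennreal_of_nat_eq_real_of_nat)
    then show ?thesis
      by (simp add: h_def)
  qed
  then have "t \<le> 0"
    by (meson ex_less_of_nat_mult not_le)
  then have "t = 0"
    by (simp add: t_def measure_le_0_iff)
  then show ?thesis
    using fin by (simp add: t_def T_def emeasure_eq_ennreal_measure)
qed

lemma exists_hit_radius:
  assumes "\<eta> < 1"
  obtains \<rho> where "0 < \<rho>" "\<rho> < 1" "measure \<mu> (hit 0 \<rho>) > \<eta>"
proof -
  \<comment> \<open>Radii increasing to 1, kept positive by the shift 2. Their union of hitting
    lines misses only the tangent lines of the unit sphere, so continuity from below
    applies.\<close>
  define \<rho> where "\<rho> k = 1 - 1 / real (k + 2)" for k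
  have \<rho>: "0 < \<rho> k" "\<rho> k < 1" for k
    by (auto simp: \<rho>_def)
  have "(\<Union>k. hit 0 (\<rho> k)) = hit 0 1 - {L :: (real^'d) set. L \<in> lines \<and> infdist 0 L = 1}"
  proof (intro subset_antisym subsetI)
    fix L :: "(real^'d) set" assume "L \<in> hit 0 1 - {L \<in> lines. infdist 0 L = 1}"
    then have L: "L \<in> lines" "infdist 0 L < 1"
      by (auto simp: hit_def)
    then obtain k where "inverse (real (Suc k)) < 1 - infdist 0 L"
      using reals_Archimedean[of "1 - infdist 0 L"] by auto
    moreover have "1 / real (k + 2) \<le> inverse (real (Suc k))"
      by (simp add: field_simps)
    ultimately have "L \<in> hit 0 (\<rho> k)"
      using L by (simp add: hit_def \<rho>_def)
    then show "L \<in> (\<Union>k. hit 0 (\<rho> k))"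
      by blast
  next
    fix L :: "(real^'d) set" assume "L \<in> (\<Union>k. hit 0 (\<rho> k))"
    then obtain k where "L \<in> hit 0 (\<rho> k)"
      by blast
    with \<rho>(2)[of k] show "L \<in> hit 0 1 - {L \<in> lines. infdist 0 L = 1}"
      by (auto simp: hit_def)
  qed
  moreover have "emeasure \<mu> (hit 0 1 - {L \<in> lines. infdist 0 L = 1}) = emeasure \<mu> (hit 0 1)"
  proof (rule emeasure_Diff_null_set)
    show "{L \<in> lines. infdist 0 L = 1} \<in> null_sets \<mu>"
      using emeasure_tangent_lines[of 0] sets_lines_infdist[of "\<lambda>t. t = 1" 0] by auto
  qed simp
  ultimately have "emeasure \<mu> (\<Union>k. hit 0 (\<rho> k)) = 1"
    by (simp add: emeasure_hit_1)
  moreover have "(\<lambda>k. emeasure \<mu> (hit 0 (\<rho> k))) \<longlonglongrightarrow> emeasure \<mu> (\<Union>k. hit 0 (\<rho> k))"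
    by (rule Lim_emeasure_incseq)
      (auto simp: incseq_def \<rho>_def intro!: hit_mono divide_left_mono)
  ultimately have "(\<lambda>k. ennreal (measure \<mu> (hit 0 (\<rho> k)))) \<longlonglongrightarrow> ennreal 1"
    using emeasure_hit_finite by (simp add: emeasure_eq_ennreal_measure less_top)
  then have "(\<lambda>k. measure \<mu> (hit 0 (\<rho> k))) \<longlonglongrightarrow> 1"
    by (subst (asm) tendsto_ennreal_iff) auto
  then have "eventually (\<lambda>k. measure \<mu> (hit 0 (\<rho> k)) > \<eta>) sequentially"
    using assms by (rule order_tendstoD)
  then obtain k where "measure \<mu> (hit 0 (\<rho> k)) > \<eta>"
    by (meson eventually_sequentially order_refl)
  with \<rho> that show ?thesis
    by blast
qed

end

text \<open>Seen from a point \<open>a\<close> of the line near the origin, the points near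
  \<open>p\<close> and \<open>q\<close> have parameters \<open>l\<close>, \<open>m\<close> with
  absolute values within 2 of the common norm. So l and m agree within 4 up to sign, that is, p is
  close to q or to -q. The constants are 4 + 1 + 1, and 4 + 2 + 1 + 1, where the extra 2 bounds the
  norm of 2a.\<close>

lemma hit_three_balls:
  fixes p q :: "real^'d"
  assumes L: "L \<in> hit 0 1" "L \<in> hit p 1" "L \<in> hit q 1" and eq: "norm p = norm q"
  shows "norm (p - q) \<le> 6 \<or> norm (p + q) \<le> 8"
proof -
  have "L \<in> lines"
    using L by (simp add: hit_def)
  note att = infdist_line_attained[OF this]
  obtain a where a: "a \<in> L" "norm a \<le> 1"
    using L(1) att[of 0] by (force simp: hit_def)
  obtain p' where p': "p' \<in> L" "norm (p - p') \<le> 1"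
    using L(2) att[of p] by (force simp: hit_def dist_norm)
  obtain q' where q': "q' \<in> L" "norm (q - q') \<le> 1"
    using L(3) att[of q] by (force simp: hit_def dist_norm)
  obtain v where v: "norm v = 1" "L = line_through a v"
    using \<open>L \<in> lines\<close> a(1) by (rule lines_eq_line_through)
  obtain l m where l: "p' = a + l *\<^sub>R v" and m: "q' = a + m *\<^sub>R v"
    using p'(1) q'(1) by (auto simp: v(2) line_through_def)
  have "\<bar>norm (l *\<^sub>R v) - norm p\<bar> \<le> norm (l *\<^sub>R v - p)"
    by (rule norm_triangle_ineq3)
  also have "l *\<^sub>R v - p = - (p - p') - a"
    by (simp add: l)
  also have "norm (- (p - p') - a) \<le> 1 + 1"
    using p'(2) a(2) by (intro order_trans[OF norm_triangle_ineq4]) (simp only: norm_minus_cancel add_mono)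
  finally have l': "\<bar>\<bar>l\<bar> - norm p\<bar> \<le> 2"
    using v(1) by simp
  have "\<bar>norm (m *\<^sub>R v) - norm q\<bar> \<le> norm (m *\<^sub>R v - q)"
    by (rule norm_triangle_ineq3)
  also have "m *\<^sub>R v - q = - (q - q') - a"
    by (simp add: m)
  also have "norm (- (q - q') - a) \<le> 1 + 1"
    using q'(2) a(2) by (intro order_trans[OF norm_triangle_ineq4]) (simp only: norm_minus_cancel add_mono)
  finally have m': "\<bar>\<bar>m\<bar> - norm q\<bar> \<le> 2"
    using v(1) by simp
  from l' m' eq consider "\<bar>l - m\<bar> \<le> 4" | "\<bar>l + m\<bar> \<le> 4"
    by linarith
  then show ?thesis
  proof cases
    case 1
    have "p - q = (l - m) *\<^sub>R v + ((p - p') - (q - q'))"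
      by (simp add: l m algebra_simps)
    then have "norm (p - q) \<le> norm ((l - m) *\<^sub>R v) + (norm (p - p') + norm (q - q'))"
      by (simp only:) (intro norm_triangle_mono order_refl norm_triangle_ineq4)
    then show ?thesis
      using 1 v(1) p'(2) q'(2) by simp
  next
    case 2
    have "p + q = ((l + m) *\<^sub>R v + 2 *\<^sub>R a) + ((p - p') + (q - q'))"
      by (simp add: l m algebra_simps scaleR_2)
    then have "norm (p + q) \<le> (norm ((l + m) *\<^sub>R v) + norm (2 *\<^sub>R a)) + (norm (p - p') + norm (q - q'))"
      by (simp only:) (intro norm_triangle_mono add_mono order_refl norm_triangle_ineq)
    then show ?thesis
      using 2 v(1) p'(2) q'(2) a(2) by simp
  qed
qed

context invariant_lines
begin

text \<open>Rotating the second ball about the first produces about \<open>norm y / 7\<close> disjoint sets of lines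
  of equal measure, all of which hit the first ball.\<close>

lemma measure_hit_two_origin:
  assumes "norm y \<ge> 6"
  shows "measure \<mu> (hit 0 1 \<inter> hit y 1) \<le> 7 / norm y"
proof -
  obtain a b :: 'd where ab: "a \<noteq> b"
    by (rule obtain_axes)
  define r where "r = norm y"
  have r: "r \<ge> 6"
    using assms by (simp add: r_def)
  define k where "k = nat \<lfloor>r / 7\<rfloor>"
  have k: "7 * real i \<le> r" if "i \<le> k" for i
  proof -
    have "real i \<le> r / 7"
      using that r unfolding k_def by (simp add: le_nat_floor nat_le_iff le_nat_iff le_floor_iff)
    then show ?thesis by simp
  qed
  \<comment> \<open>Points on a quarter circle of radius \<open>r\<close>, at heights 0, 7, 14, ...
    up to r. Height steps of 7 exceed the 6 of \<open>hit_three_balls\<close>; staying in one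
    quadrant excludes the antipodal alternative.\<close>
  define p where "p i = sqrt (r\<^sup>2 - (7 * real i)\<^sup>2) *\<^sub>R axis a 1 + (7 * real i) *\<^sub>R axis b (1::real)" for i :: nat
  have axes: "axis a (1::real) $ b = 0" "axis b (1::real) $ a = 0"
    using ab by (auto simp: axis_def)
  have pp: "p i \<bullet> p j = sqrt (r\<^sup>2 - (7 * real i)\<^sup>2) * sqrt (r\<^sup>2 - (7 * real j)\<^sup>2) + 49 * real i * real j" for i j
    unfolding p_def
    by (simp add: inner_add_left inner_add_right inner_axis_axis ab ab[symmetric])
  have sq: "(7 * real i)\<^sup>2 \<le> r\<^sup>2" if "i \<le> k" for i
    using k[OF that] by (intro power_mono) auto
  have norm_p: "norm (p i) = r" if "i \<le> k" for i
    using sq[OF that] r unfolding norm_eq_sqrt_inner pp by (simp add: power_mult_distrib power2_eq_square)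
  define E where "E i = hit 0 1 \<inter> hit (p i) 1" for i
  have disj: "disjoint_family_on E {..k}"
  unfolding disjoint_family_on_def
  proof (intro ballI impI)
    fix i j assume ij: "i \<in> {..k}" "j \<in> {..k}" "i \<noteq> j"
    have "(p i - p j) $ b = 7 * real i - 7 * real j"
      by (simp add: p_def axes)
    moreover have "\<bar>7 * real i - 7 * real j\<bar> \<ge> 7"
      using ij(3) by linarith
    ultimately have far: "norm (p i - p j) > 6"
      using component_le_norm_cart[of "p i - p j" b] by linarith
    have "p i \<bullet> p i = r\<^sup>2" "p j \<bullet> p j = r\<^sup>2"
      using norm_p[of i] norm_p[of j] ij by (simp_all add: dot_square_norm)
    then have "(norm (p i + p j))\<^sup>2 = 2 * r\<^sup>2 + 2 * (p i \<bullet> p j)"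
      by (simp add: power2_norm_eq_inner inner_add_left inner_add_right inner_commute)
    moreover have "p i \<bullet> p j \<ge> 0"
      using sq[of i] sq[of j] ij unfolding pp by (intro add_nonneg_nonneg mult_nonneg_nonneg) auto
    \<comment> \<open>Nonnegative inner products leave at least 2 * 36 = 72 > 64, which is where the
      hypothesis on \<open>norm y\<close> is spent.\<close>
    moreover have "r\<^sup>2 \<ge> 6\<^sup>2"
      using r by (intro power_mono) auto
    ultimately have "(norm (p i + p j))\<^sup>2 > 8\<^sup>2"
      by simp
    then have "norm (p i + p j) > 8"
      by (rule power2_less_imp_less) simp
    with far show "E i \<inter> E j = {}"
      using hit_three_balls[of _ "p i" "p j"] norm_p[of i] norm_p[of j] ij by (fastforce simp: E_def)
  qed
  have E_sets: "E i \<in> fmeasurable \<mu>" for i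
    unfolding E_def by (intro fmeasurable.Int) auto
  have E_eq: "measure \<mu> (E i) = measure \<mu> (hit 0 1 \<inter> hit y 1)" if i: "i \<le> k" for i
  proof -
    have "norm y = norm (p i)"
      using norm_p[OF i] by (simp add: r_def)
    then obtain Q where Q: "orthogonal_transformation Q" "Q y = p i"
      by (rule orthogonal_transformation_exists)
    have "inj ((`) Q)"
      using orthogonal_transformation_inj[OF Q(1)] by (simp add: inj_image_eq_iff inj_def)
    then have "(`) Q ` (hit 0 1 \<inter> hit y 1) = (`) Q ` hit 0 1 \<inter> (`) Q ` hit y 1"
      by (rule image_Int)
    also have "\<dots> = E i"
      using Q image_orthogonal_lines[OF Q(1), of "\<lambda>t. t \<le> 1"]
        orthogonal_transformation_linear[OF Q(1)] linear_0[of Q]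
      by (simp add: E_def hit_def)
    finally show ?thesis
      using mu_orthogonal[OF Q(1), of "hit 0 1 \<inter> hit y 1"] by (simp add: measure_def)
  qed
  have "real (Suc k) * measure \<mu> (hit 0 1 \<inter> hit y 1) = (\<Sum>i\<le>k. measure \<mu> (E i))"
    by (simp add: E_eq)
  also have "\<dots> = measure \<mu> (\<Union>i\<le>k. E i)"
    using disj E_sets by (intro measure_UNION'[symmetric]) (auto simp: disjoint_family_on_def pairwise_def disjnt_def)
  also have "\<dots> \<le> measure \<mu> (hit 0 1)"
    using E_sets by (intro measure_mono_fmeasurable) (auto simp: E_def)
  finally have *: "real (Suc k) * measure \<mu> (hit 0 1 \<inter> hit y 1) \<le> 1"
    by (simp add: measure_hit_1)
  \<comment> \<open>The indices run from 0 to \<open>k\<close>, so there are \<open>Suc k\<close>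
    disjoint copies, enough to absorb the rounding in \<open>k\<close>.\<close>
  have "r / 7 \<le> real (Suc k)"
    unfolding k_def using r by linarith
  then have "r / 7 * measure \<mu> (hit 0 1 \<inter> hit y 1) \<le> real (Suc k) * measure \<mu> (hit 0 1 \<inter> hit y 1)"
    by (intro mult_right_mono) auto
  then have "r / 7 * measure \<mu> (hit 0 1 \<inter> hit y 1) \<le> 1"
    using * by (rule order_trans)
  then have "measure \<mu> (hit 0 1 \<inter> hit y 1) * r \<le> 7"
    by (simp add: mult.commute)
  then have "measure \<mu> (hit 0 1 \<inter> hit y 1) \<le> 7 / r"
    using r by (subst pos_le_divide_eq) auto
  then show ?thesis
    by (simp only: r_def)
qed

lemma measure_hit_two:
  assumes "dist x y \<ge> 6"
  shows "measure \<mu> (hit x 1 \<inter> hit y 1) \<le> 7 / dist x y"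
proof -
  have "inj ((`) ((+) x))"
    by (simp add: inj_def inj_image_eq_iff)
  then have "(`) ((+) x) ` (hit 0 1 \<inter> hit (y - x) 1) = (`) ((+) x) ` hit 0 1 \<inter> (`) ((+) x) ` hit (y - x) 1"
    by (rule image_Int)
  also have "\<dots> = hit x 1 \<inter> hit y 1"
    using image_translation_lines[of x "\<lambda>t. t \<le> 1"] by (simp add: hit_def)
  finally have "measure \<mu> (hit x 1 \<inter> hit y 1) = measure \<mu> (hit 0 1 \<inter> hit (y - x) 1)"
    using mu_translation[of "hit 0 1 \<inter> hit (y - x) 1" x] by (simp add: measure_def)
  with measure_hit_two_origin[of "y - x"] assms show ?thesis
    by (simp add: dist_norm norm_minus_commute)
qed

end

section \<open>Box numbers and separated sets\<close>

text \<open>The \<open>LEAST\<close> in \<open>box_number\<close> says something only once a finite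
  cover exists; total boundedness of the closure supplies one.\<close>

lemma box_number_cover:
  fixes A :: "(real^'d) set"
  assumes "bounded A" "0 < \<delta>"
  obtains C where "finite C" "card C = box_number \<delta> A" "A \<subseteq> (\<Union>x\<in>C. cbox x (x + (\<chi> i. \<delta>)))"
proof -
  let ?h = "(\<chi> i. \<delta> / 2) :: real^'d"
  have "compact (closure A)"
    using assms(1) by simp
  then obtain F where F: "finite F" "closure A \<subseteq> (\<Union>x\<in>F. ball x (\<delta> / 2))"
    using assms(2) unfolding compact_eq_totally_bounded by (meson half_gt_zero)
  have sub: "ball x (\<delta> / 2) \<subseteq> cbox (x - ?h) (x - ?h + (\<chi> i. \<delta>))" for x
  proof
    fix y assume "y \<in> ball x (\<delta> / 2)"
    then have *: "\<bar>y $ i - x $ i\<bar> < \<delta> / 2" for i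
      using component_le_norm_cart[of "y - x" i] by (auto simp: dist_norm norm_minus_commute)
    have "x $ i - \<delta> / 2 \<le> y $ i \<and> y $ i \<le> x $ i - \<delta> / 2 + \<delta>" for i
      using *[of i] by linarith
    then show "y \<in> cbox (x - ?h) (x - ?h + (\<chi> i. \<delta>))"
      by (simp add: mem_box_cart)
  qed
  have "A \<subseteq> (\<Union>x\<in>(\<lambda>x. x - ?h) ` F. cbox x (x + (\<chi> i. \<delta>)))"
  proof
    fix y assume "y \<in> A"
    then obtain x where "x \<in> F" "y \<in> ball x (\<delta> / 2)"
      using F(2) closure_subset by blast
    with sub[of x] show "y \<in> (\<Union>x\<in>(\<lambda>x. x - ?h) ` F. cbox x (x + (\<chi> i. \<delta>)))"
      by blast
  qed
  then have "\<exists>k C. finite C \<and> card C = k \<and> A \<subseteq> (\<Union>x\<in>C. cbox x (x + (\<chi> i. \<delta>)))"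
    using F(1) by blast
  then have "\<exists>C. finite C \<and> card C = box_number \<delta> A \<and> A \<subseteq> (\<Union>x\<in>C. cbox x (x + (\<chi> i. \<delta>)))"
    unfolding box_number_def by (rule LeastI_ex)
  then show ?thesis
    using that by blast
qed

lemma box_number_pos:
  assumes "bounded A" "A \<noteq> {}" "0 < \<delta>"
  shows "box_number \<delta> A > 0"
proof -
  obtain C where "finite C" "card C = box_number \<delta> A" "A \<subseteq> (\<Union>x\<in>C. cbox x (x + (\<chi> i. \<delta>)))"
    using box_number_cover[OF assms(1,3)] .
  with assms(2) show ?thesis
    by (auto simp: card_gt_0_iff simp flip: \<open>card C = box_number \<delta> A\<close>)
qed

text \<open>Greedy choice: fewer than \<open>box_number (2 * \<delta>) A\<close> cubes of side
  \<open>2 * \<delta>\<close> centred at the points chosen so far leave some point of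
  \<open>A\<close> uncovered. That point differs from each chosen one by more than
  \<open>\<delta>\<close> in some coordinate.\<close>

lemma separated_subset:
  fixes A :: "(real^'d) set"
  assumes "0 < \<delta>" "k \<le> box_number (2 * \<delta>) A"
  shows "\<exists>F\<subseteq>A. finite F \<and> card F = k \<and> (\<forall>x\<in>F. \<forall>y\<in>F. x \<noteq> y \<longrightarrow> dist x y > \<delta>)"
  using assms(2)
proof (induction k)
  case 0
  then show ?case
    by (intro exI[of _ "{}"]) auto
next
  case (Suc k)
  then obtain F where F: "F \<subseteq> A" "finite F" "card F = k" "\<forall>x\<in>F. \<forall>y\<in>F. x \<noteq> y \<longrightarrow> dist x y > \<delta>"
    by auto
  let ?h = "(\<chi> i. \<delta>) :: real^'d"
  define C where "C = (\<lambda>x. x - ?h) ` F"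
  have "finite C" "card C = k"
    using F unfolding C_def by (auto intro!: card_image[THEN trans] inj_onI)
  moreover have "k < box_number (2 * \<delta>) A"
    using Suc.prems by simp
  ultimately have "\<not> A \<subseteq> (\<Union>x\<in>C. cbox x (x + (\<chi> i. 2 * \<delta>)))"
    unfolding box_number_def using not_less_Least by blast
  then obtain a where a: "a \<in> A" "a \<notin> (\<Union>x\<in>C. cbox x (x + (\<chi> i. 2 * \<delta>)))"
    by blast
  have far: "dist a x > \<delta>" if "x \<in> F" for x
  proof (rule ccontr)
    assume "\<not> dist a x > \<delta>"
    then have *: "\<bar>a $ i - x $ i\<bar> \<le> \<delta>" for i
      using component_le_norm_cart[of "a - x" i] by (auto simp: dist_norm)
    have "x $ i - \<delta> \<le> a $ i \<and> a $ i \<le> x $ i - \<delta> + 2 * \<delta>" for i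
      using *[of i] by linarith
    then have "a \<in> cbox (x - ?h) (x - ?h + (\<chi> i. 2 * \<delta>))"
      by (simp add: mem_box_cart)
    with that a(2) show False
      by (auto simp: C_def)
  qed
  have "a \<notin> F"
    using far[of a] assms(1) by auto
  then show ?case
    using F a(1) far by (intro exI[of _ "insert a F"]) (auto simp: dist_commute)
qed

section \<open>Second moment method\<close>

text \<open>Chebyshev for the number of events that occur: if none does, that number misses its mean
  by the whole mean. The factor \<open>q\<close> measures the excess over pairwise independence,
  which is \<open>q = 1\<close>.\<close>

lemma (in prob_space) second_moment_none:
  assumes I: "finite I" "I \<noteq> {}"
    and U: "\<And>i. i \<in> I \<Longrightarrow> U i \<in> events" "\<And>i. i \<in> I \<Longrightarrow> prob (U i) = p" "0 < p"
    and pair: "\<And>i j. i \<in> I \<Longrightarrow> j \<in> I \<Longrightarrow> i \<noteq> j \<Longrightarrow> prob (U i \<inter> U j) \<le> p\<^sup>2 * q"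
    and q: "0 \<le> q"
  shows "prob {\<omega> \<in> space M. \<forall>i\<in>I. \<omega> \<notin> U i} \<le> 1 / (real (card I) * p) + (q - 1)"
proof -
  define N where "N = real (card I)"
  have N: "N > 0"
    using I by (simp add: N_def card_gt_0_iff)
  define X where "X \<omega> = (\<Sum>i\<in>I. indicator (U i) \<omega> :: real)" for \<omega>
  have [measurable]: "X \<in> borel_measurable M"
    unfolding X_def using U(1) by measurable
  have int1: "integrable M (\<lambda>\<omega>. indicator (U i) \<omega> :: real)" if "i \<in> I" for i
    using U(1)[OF that] by (simp add: less_top[symmetric])
  have EX: "expectation X = N * p"
    unfolding X_def using U I(1) int1 by (subst Bochner_Integration.integral_sum) (auto simp: N_def)
  have X2: "(X \<omega>)\<^sup>2 = (\<Sum>i\<in>I. \<Sum>j\<in>I. indicator (U i \<inter> U j) \<omega>)" for \<omega>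
    unfolding X_def power2_eq_square sum_product by (simp add: indicator_inter_arith)
  have int2: "integrable M (\<lambda>\<omega>. indicator (U i \<inter> U j) \<omega> :: real)" if "i \<in> I" "j \<in> I" for i j
    using U(1)[OF that(1)] U(1)[OF that(2)] by (simp add: less_top[symmetric])
  have intX2: "integrable M (\<lambda>\<omega>. (X \<omega>)\<^sup>2)"
    unfolding X2 using int2 by (intro Bochner_Integration.integrable_sum) auto
  have intX: "integrable M X"
    unfolding X_def[abs_def] using int1 by (intro Bochner_Integration.integrable_sum) auto
  have "expectation (\<lambda>\<omega>. (X \<omega>)\<^sup>2) = (\<Sum>i\<in>I. \<Sum>j\<in>I. prob (U i \<inter> U j))"
    unfolding X2 using int2 U(1)
    by (subst Bochner_Integration.integral_sum Bochner_Integration.integrable_sum;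
        auto intro!: sum.cong simp: Bochner_Integration.integral_sum)+
  \<comment> \<open>The diagonal also receives the term \<open>p\<^sup>2 * q\<close>, harmless as
    \<open>q\<close> is nonnegative, so that the double sum factors.\<close>
  also have "\<dots> \<le> (\<Sum>i\<in>I. \<Sum>j\<in>I. (if i = j then p else 0) + p\<^sup>2 * q)"
    using pair U q by (intro sum_mono) auto
  also have "\<dots> = N * p + (N * p)\<^sup>2 * q"
    using I(1) by (simp add: sum.distrib N_def power2_eq_square algebra_simps)
  finally have var: "variance X \<le> N * p + (N * p)\<^sup>2 * q - (N * p)\<^sup>2"
    using variance_eq[OF intX intX2] EX by simp
  have "prob {\<omega> \<in> space M. \<forall>i\<in>I. \<omega> \<notin> U i} \<le> prob {\<omega> \<in> space M. \<bar>X \<omega> - expectation X\<bar> \<ge> N * p}"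
  proof (rule finite_measure_mono)
    show "{\<omega> \<in> space M. \<forall>i\<in>I. \<omega> \<notin> U i} \<subseteq> {\<omega> \<in> space M. \<bar>X \<omega> - expectation X\<bar> \<ge> N * p}"
      using N U(3) by (auto simp: EX X_def)
  qed measurable
  also have "\<dots> \<le> variance X / (N * p)\<^sup>2"
    using N U(3) intX2 by (intro Chebyshev_inequality) auto
  also have "\<dots> \<le> (N * p + (N * p)\<^sup>2 * q - (N * p)\<^sup>2) / (N * p)\<^sup>2"
    using var by (rule divide_right_mono) simp
  also have "\<dots> = 1 / (N * p) + (q - 1)"
    using N U(3) by (simp add: field_simps power2_eq_square)
  finally show ?thesis
    by (simp add: N_def)
qed

section \<open>Covering by the Poisson line process\<close>

definition covers :: "((real^'d) set \<times> real) set \<Rightarrow> (real^'d) set \<Rightarrow> real \<Rightarrow> bool" where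
  "covers \<psi> A t \<longleftrightarrow> A \<subseteq> (\<Union>(L, s)\<in>{(L, s)\<in>\<psi>. s \<le> t}. cylinder L)"

lemma covers_mono: "covers \<psi> A s \<Longrightarrow> s \<le> t \<Longrightarrow> covers \<psi> A t"
  unfolding covers_def by force

lemma cover_time_covers: "cover_time \<psi> A = Inf {ereal t | t. 0 < t \<and> covers \<psi> A t}"
  by (simp add: cover_time_def covers_def)

lemma cover_time_nonneg: "0 \<le> cover_time \<psi> A"
  unfolding cover_time_covers by (rule Inf_greatest) auto

lemma cover_time_le: "0 < t \<Longrightarrow> covers \<psi> A t \<Longrightarrow> cover_time \<psi> A \<le> ereal t"
  unfolding cover_time_covers by (rule Inf_lower) auto

lemma cover_time_leD:
  assumes "cover_time \<psi> A \<le> ereal s" "s < t"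
  shows "covers \<psi> A t"
proof -
  have "cover_time \<psi> A < ereal t"
    using assms by (metis ereal_less(2) less_ereal.simps(1) order_le_less_trans)
  then obtain u where "u < t" "covers \<psi> A u"
    unfolding cover_time_covers by (auto simp: Inf_less_iff)
  then show ?thesis
    by (meson covers_mono less_imp_le)
qed

text \<open>Attainment of the infimum is not established; a sequence of times decreasing to
  \<open>t\<close> replaces it and yields a countable intersection of events.\<close>

lemma cover_time_le_iff:
  assumes "0 \<le> t"
  shows "cover_time \<psi> A \<le> ereal t \<longleftrightarrow> (\<forall>k. covers \<psi> A (t + inverse (real (Suc k))))"
proof
  assume "cover_time \<psi> A \<le> ereal t"
  then show "\<forall>k. covers \<psi> A (t + inverse (real (Suc k)))"
    by (auto elim!: cover_time_leD)
next
  assume *: "\<forall>k. covers \<psi> A (t + inverse (real (Suc k)))"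
  show "cover_time \<psi> A \<le> ereal t"
  proof (rule ereal_le_epsilon2)
    fix e :: real assume "0 < e"
    then obtain k where k: "inverse (real (Suc k)) < e"
      using reals_Archimedean by blast
    have "0 < t + inverse (real (Suc k))"
      using assms by (intro add_nonneg_pos) auto
    then have "cover_time \<psi> A \<le> ereal (t + inverse (real (Suc k)))"
      using * by (intro cover_time_le) auto
    also have "\<dots> \<le> ereal t + ereal e"
      using k by simp
    finally show "cover_time \<psi> A \<le> ereal t + ereal e" .
  qed
qed

lemma closed_cylinder: "closed (cylinder L)"
  unfolding cylinder_def by (intro closed_Collect_le continuous_intros)

locale poisson_lines = invariant_lines \<mu> + prob_space M
  for \<mu> :: "(real^'d) set measure" and M :: "'w measure" +
  fixes \<Psi> :: "'w \<Rightarrow> ((real^'d) set \<times> real) set"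
  assumes poisson: "poisson_line_process M \<mu> \<Psi>"
begin

abbreviation "time_measure \<equiv> restrict_space lborel {0 :: real..}"

lemma points_subset: "\<omega> \<in> space M \<Longrightarrow> \<Psi> \<omega> \<subseteq> lines \<times> {0..}"
  and points_finite: "\<omega> \<in> space M \<Longrightarrow>
      compactin (prod_topology line_topology (top_of_set {0..})) K \<Longrightarrow> finite (\<Psi> \<omega> \<inter> K)"
  and measurable_count: "B \<in> sets (\<mu> \<Otimes>\<^sub>M time_measure) \<Longrightarrow>
      (\<lambda>\<omega>. count_in (\<Psi> \<omega>) B) \<in> borel_measurable M"
  and prob_count: "B \<in> sets (\<mu> \<Otimes>\<^sub>M time_measure) \<Longrightarrow> emeasure (\<mu> \<Otimes>\<^sub>M time_measure) B < \<infinity> \<Longrightarrow>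
      prob {\<omega> \<in> space M. count_in (\<Psi> \<omega>) B = of_nat k} =
        exp (- measure (\<mu> \<Otimes>\<^sub>M time_measure) B) * measure (\<mu> \<Otimes>\<^sub>M time_measure) B ^ k / fact k"
  using poisson unfolding poisson_line_process_def poisson_point_process_def
  by (auto simp: topspace_line_topology)

definition missed :: "(real^'d) set set \<Rightarrow> real \<Rightarrow> 'w set" where
  "missed S t = {\<omega> \<in> space M. \<Psi> \<omega> \<inter> (S \<times> {0..t}) = {}}"

lemma missed_count: "missed S t = {\<omega> \<in> space M. count_in (\<Psi> \<omega>) (S \<times> {0..t}) = 0}"
  by (simp add: missed_def count_in_def emeasure_count_space_eq_0)

text \<open>Joint probabilities thereby become void probabilities of unions, governed by
  inclusion-exclusion for \<open>\<mu>\<close>.\<close>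

lemma missed_Un: "missed (S \<union> T) t = missed S t \<inter> missed T t"
  by (auto simp: missed_def)

lemma sets_time: "{0..t} \<in> sets time_measure"
  by (auto simp: sets_restrict_space intro!: image_eqI[of _ _ "{0..t}"])

lemma sets_missed [measurable, intro, simp]:
  assumes [measurable]: "S \<in> sets \<mu>"
  shows "missed S t \<in> events"
proof -
  have [measurable]: "(\<lambda>\<omega>. count_in (\<Psi> \<omega>) (S \<times> {0..t})) \<in> borel_measurable M"
    using assms sets_time by (intro measurable_count pair_measureI)
  show ?thesis
    unfolding missed_count by measurable
qed

text \<open>The count 0 in the Poisson law. The product formula for the intensity uses
  sigma-finiteness of the time axis.\<close>

lemma prob_missed:
  assumes S: "S \<in> fmeasurable \<mu>" and t: "0 \<le> t"
  shows "prob (missed S t) = exp (- (t * measure \<mu> S))"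
proof -
  have "sigma_finite_measure time_measure"
    by (intro sigma_finite_measure_restrict_space) (auto intro: sigma_finite_lborel)
  then interpret T: sigma_finite_measure time_measure .
  have "emeasure time_measure {0..t} = emeasure lborel {0..t}"
    by (rule emeasure_restrict_space) auto
  then have time: "emeasure time_measure {0..t} = ennreal t"
    using t by simp
  have "emeasure (\<mu> \<Otimes>\<^sub>M time_measure) (S \<times> {0..t}) = emeasure \<mu> S * ennreal t"
    using S sets_time by (subst T.emeasure_pair_measure_Times) (auto simp: time)
  also have "\<dots> = ennreal (t * measure \<mu> S)"
    using S t by (simp add: emeasure_eq_measure2 ennreal_mult mult.commute)
  finally have e: "emeasure (\<mu> \<Otimes>\<^sub>M time_measure) (S \<times> {0..t}) = ennreal (t * measure \<mu> S)" .
  then have "measure (\<mu> \<Otimes>\<^sub>M time_measure) (S \<times> {0..t}) = t * measure \<mu> S"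
    using t by (simp add: measure_def)
  then show ?thesis
    using prob_count[of "S \<times> {0..t}" 0] S sets_time[of t] e
    by (simp add: missed_count)
qed

lemma covers_iff:
  assumes "\<omega> \<in> space M"
  shows "covers (\<Psi> \<omega>) A t \<longleftrightarrow> (\<forall>x\<in>A. \<omega> \<notin> missed (hit x 1) t)"
  using points_subset[OF assms] assms
  unfolding covers_def missed_def cylinder_def hit_def by fastforce

text \<open>By local finiteness the union of the cylinders is closed within bounded regions, so it is
  enough to cover a dense subset.\<close>

lemma covers_dense:
  assumes \<omega>: "\<omega> \<in> space M" and "bounded A" "D \<subseteq> A" "A \<subseteq> closure D" "covers (\<Psi> \<omega>) D t"
  shows "covers (\<Psi> \<omega>) A t"
proof -
  obtain R where R: "A \<subseteq> cball 0 R"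
    using \<open>bounded A\<close> by (force simp: bounded_iff)
  \<comment> \<open>A cylinder meeting the ball of radius \<open>R\<close> has its axis within
    \<open>R + 1\<close> of the origin, so \<open>F\<close> contains every relevant process
    point.\<close>
  define F where "F = \<Psi> \<omega> \<inter> (hit 0 (R + 1) \<times> {0..t})"
  have "compactin (top_of_set {0..}) {0..t}"
    by (auto simp: compactin_subtopology)
  then have "finite F"
    unfolding F_def using compactin_hit[of 0 "R + 1"] \<omega>
    by (intro points_finite) (auto simp: compactin_Times)
  then have "closed (\<Union>(L, s)\<in>F. cylinder L)"
    by (intro closed_UN) (auto simp: closed_cylinder)
  moreover have "D \<subseteq> (\<Union>(L, s)\<in>F. cylinder L)"
  proof
    fix x assume x: "x \<in> D"
    then obtain L s where L: "(L, s) \<in> \<Psi> \<omega>" "s \<le> t" "infdist x L \<le> 1"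
      using assms(5) by (fastforce simp: covers_def cylinder_def)
    have "L \<in> lines" "0 \<le> s"
      using L(1) points_subset[OF \<omega>] by auto
    moreover have "dist x 0 \<le> R"
      using x assms(3) R by (auto simp: dist_commute)
    ultimately have "(L, s) \<in> F"
      using L infdist_translate_bound[of x L 1 0 R] by (simp add: F_def hit_def add.commute)
    with L(3) show "x \<in> (\<Union>(L, s)\<in>F. cylinder L)"
      by (force simp: cylinder_def)
  qed
  ultimately have "closure D \<subseteq> (\<Union>(L, s)\<in>F. cylinder L)"
    by (rule closure_minimal[rotated])
  also have "\<dots> \<subseteq> (\<Union>(L, s)\<in>{(L, s)\<in>\<Psi> \<omega>. s \<le> t}. cylinder L)"
    by (force simp: F_def)
  finally show ?thesis
    using assms(4) unfolding covers_def by blast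
qed

text \<open>A countable dense subset turns the uncountable intersection over \<open>A\<close> into a
  countable one.\<close>

lemma sets_covers [measurable]:
  assumes "bounded A"
  shows "{\<omega> \<in> space M. covers (\<Psi> \<omega>) A t} \<in> events"
proof -
  obtain D where D: "countable D" "D \<subseteq> A" "A \<subseteq> closure D"
    using separable by blast
  have "{\<omega> \<in> space M. covers (\<Psi> \<omega>) A t} = {\<omega> \<in> space M. covers (\<Psi> \<omega>) D t}"
    using covers_dense[OF _ assms D(2,3)] D(2) by (auto simp: covers_def)
  also have "\<dots> = space M - (\<Union>x\<in>D. missed (hit x 1) t)"
    by (auto simp: covers_iff)
  also have "\<dots> \<in> events"
    using D(1) by (intro sets.Diff sets.countable_UN') auto
  finally show ?thesis .
qed

text \<open>A set outside \<open>events\<close> has \<open>prob\<close> 0 by convention, so the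
  limit 1 could not be reached without measurability.\<close>

lemma sets_cover_time:
  assumes "bounded A"
  shows "{\<omega> \<in> space M. cover_time (\<Psi> \<omega>) A \<le> ereal t} \<in> events"
proof (cases "0 \<le> t")
  case True
  have [measurable]: "{\<omega> \<in> space M. covers (\<Psi> \<omega>) A s} \<in> events" for s
    using assms by (rule sets_covers)
  show ?thesis
    unfolding cover_time_le_iff[OF True] by measurable
next
  case False
  then have "ereal t < cover_time (\<Psi> \<omega>) A" for \<omega>
    by (intro order_less_le_trans[OF _ cover_time_nonneg]) simp
  then have "{\<omega> \<in> space M. cover_time (\<Psi> \<omega>) A \<le> ereal t} = {}"
    by (auto simp: not_le)
  then show ?thesis
    by (simp only: sets.empty_sets)
qed

end

section \<open>Asymptotics\<close>

lemma tendsto_exp_ln_0: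
  assumes "0 < \<eta>"
  shows "(\<lambda>n. exp (K - \<eta> * ln (real n))) \<longlonglongrightarrow> 0"
proof (rule Lim_transform_eventually)
  show "(\<lambda>n. exp K * real n powr (- \<eta>)) \<longlonglongrightarrow> 0"
    using assms by (intro tendsto_mult_right_zero tendsto_neg_powr filterlim_real_sequentially) simp
  show "\<forall>\<^sub>F n in sequentially. exp K * real n powr (- \<eta>) = exp (K - \<eta> * ln (real n))"
    using eventually_gt_at_top[of 0] by eventually_elim (simp add: powr_def exp_diff exp_minus field_simps)
qed

lemma filterlim_ln_real: "filterlim (\<lambda>n. ln (real n)) at_top sequentially"
  by (rule filterlim_compose[OF ln_at_top filterlim_real_sequentially])

lemma eventually_less_ln:
  assumes "0 < \<alpha>"
  shows "\<forall>\<^sub>F n in sequentially. K < \<alpha> * ln (real n)"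
  using filterlim_ln_real assms
  by (intro filterlim_at_top_dense[THEN iffD1, rule_format] filterlim_tendsto_pos_mult_at_top[OF tendsto_const])

context poisson_lines
begin

section \<open>Lower bound: below the lower box dimension\<close>

lemma prob_covered_tendsto_0:
  assumes A: "bounded A" "A \<noteq> {}" and \<alpha>: "ereal \<alpha> < lower_box_dim A"
  shows "(\<lambda>n. prob {\<omega> \<in> space M. cover_time (\<Psi> \<omega>) ((\<lambda>x. real n *\<^sub>R x) ` A) \<le> ereal (z + \<alpha> * ln (real n))})
    \<longlonglongrightarrow> 0" (is "(\<lambda>n. prob (?E n)) \<longlonglongrightarrow> 0")
\<comment> \<open>For negative \<open>\<alpha>\<close> the threshold is eventually negative, whereas
  cover times are not. Otherwise the exponent \<open>l\<close> below is positive and may be divided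
  by.\<close>
proof (cases "\<alpha> < 0")
  case True
  then have "\<forall>\<^sub>F n in sequentially. z < (- \<alpha>) * ln (real n)"
    by (intro eventually_less_ln) simp
  then have "\<forall>\<^sub>F n in sequentially. prob (?E n) = 0"
  proof eventually_elim
    case (elim n)
    then have "ereal (z + \<alpha> * ln (real n)) < cover_time (\<Psi> \<omega>) ((\<lambda>x. real n *\<^sub>R x) ` A)" for \<omega>
      by (intro order_less_le_trans[OF _ cover_time_nonneg]) simp
    then have "?E n = {}"
      by (auto simp: not_le)
    then show ?case
      by (simp only: measure_empty)
  qed
  then show ?thesis
    by (rule tendsto_eventually)
next
  case False
  obtain l where l: "\<alpha> < l" "ereal l < lower_box_dim A"
    using ereal_dense2[OF \<alpha>] by auto
  \<comment> \<open>Half of 1 - \<alpha>/l, the value at which l(1-e) would drop to \<alpha>; thus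
    l(1-e) = (l+\<alpha>)/2.\<close>
  define e where "e = (l - \<alpha>) / (2 * l)"
  have e: "0 < e" "e < 1" "l * (1 - e) > \<alpha>"
    using False l(1) by (auto simp: e_def field_simps)
  \<comment> \<open>The separation in \<open>A\<close> that becomes n^e after scaling by n.\<close>
  define \<delta> where "\<delta> n = real n powr (e - 1)" for n
  \<comment> \<open>The added 1 gives the strict inequality that \<open>cover_time_leD\<close>
    needs; the maximum with 0 keeps \<open>t n\<close> nonnegative.\<close>
  define z' where "z' = max 0 z + 1"
  define t where "t n = z' + \<alpha> * ln (real n)" for n
  \<comment> \<open>The expected number of uncovered points is at least a constant times
    n^\<open>\<eta>\<close>.\<close>
  define \<eta> where "\<eta> = l * (1 - e) - \<alpha>"
  have "filterlim (\<lambda>n. 2 * \<delta> n) (at_right 0) sequentially"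
    unfolding filterlim_at
  proof
    show "\<forall>\<^sub>F n in sequentially. 2 * \<delta> n \<in> {0<..} \<and> 2 * \<delta> n \<noteq> 0"
      using eventually_gt_at_top[of 0] by eventually_elim (simp add: \<delta>_def)
    show "(\<lambda>n. 2 * \<delta> n) \<longlonglongrightarrow> 0"
      unfolding \<delta>_def using e
      by (intro tendsto_mult_right_zero tendsto_neg_powr filterlim_real_sequentially) simp
  qed
  note filterlim = this
  have "\<forall>\<^sub>F \<delta> in at_right 0. ereal l < ereal (ln (real (box_number \<delta> A)) / - ln \<delta>)"
    using l(2) unfolding lower_box_dim_def by (rule less_LiminfD)
  moreover have "\<forall>\<^sub>F \<delta> in at_right 0. 0 < \<delta> \<and> \<delta> < (1::real)"
    by (rule eventually_at_rightI[of 0 1]) auto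
  ultimately have "\<forall>\<^sub>F \<delta> in at_right 0. l * (- ln \<delta>) < ln (real (box_number \<delta> A))"
  proof eventually_elim
    case (elim \<delta>)
    then have pos: "- ln \<delta> > 0"
      by simp
    have "l < ln (real (box_number \<delta> A)) / - ln \<delta>"
      using elim(1) by (simp only: less_ereal.simps)
    then show ?case
      by (simp only: pos_less_divide_eq[OF pos])
  qed
  then have ev: "\<forall>\<^sub>F n in sequentially. l * (- ln (2 * \<delta> n)) < ln (real (box_number (2 * \<delta> n) A))"
    using filterlim by (rule eventually_compose_filterlim)
  have "\<forall>\<^sub>F n in sequentially. 6 \<le> real n powr e"
    using filterlim_compose[OF real_powr_at_top[OF e(1)] filterlim_real_sequentially]
    by (simp add: filterlim_at_top)
  moreover note ev
  moreover have "\<forall>\<^sub>F n in sequentially. 0 < ln (real n)"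
    using eventually_less_ln[of 1 0] by simp
  moreover note eventually_gt_at_top[of 0]
  ultimately have bound: "\<forall>\<^sub>F n in sequentially. prob (?E n) \<le>
      exp (z' + l * ln 2 - \<eta> * ln (real n)) + (exp (7 * (t n / real n powr e)) - 1)"
  proof eventually_elim
    case (elim n)
    define N where "N = box_number (2 * \<delta> n) A"
    have n: "n > 0" and D: "real n powr e \<ge> 6"
      using elim by auto
    have \<delta>_pos: "0 < \<delta> n"
      using n by (simp add: \<delta>_def)
    have t_pos: "0 \<le> t n"
      unfolding t_def using elim(3) False by (intro add_nonneg_nonneg mult_nonneg_nonneg) (auto simp: z'_def)
    have ln2\<delta>: "ln (2 * \<delta> n) = ln 2 - (1 - e) * ln (real n)"
      using n \<delta>_pos by (subst ln_mult) (auto simp: \<delta>_def ln_powr algebra_simps)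
    have lnN: "l * (1 - e) * ln (real n) - l * ln 2 < ln (real N)"
      using elim(2) unfolding ln2\<delta> N_def by (simp add: algebra_simps)
    obtain F where F: "F \<subseteq> A" "finite F" "card F = N" "\<And>x y. x \<in> F \<Longrightarrow> y \<in> F \<Longrightarrow> x \<noteq> y \<Longrightarrow> dist x y > \<delta> n"
      using separated_subset[OF \<delta>_pos, of N A] by (auto simp: N_def)
    have N: "N > 0"
      unfolding N_def using A \<delta>_pos by (intro box_number_pos) auto
    define U where "U x = missed (hit (real n *\<^sub>R x) 1) (t n)" for x
    have pU: "prob (U x) = exp (- t n)" for x
      unfolding U_def using t_pos by (subst prob_missed) (auto simp: measure_hit_1)
    have pair: "prob (U x \<inter> U y) \<le> (exp (- t n))\<^sup>2 * exp (7 * (t n / real n powr e))"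
      if "x \<in> F" "y \<in> F" "x \<noteq> y" for x y
    proof -
      let ?X = "hit (real n *\<^sub>R x) 1" and ?Y = "hit (real n *\<^sub>R y) 1"
      have "real n powr e = real n * \<delta> n"
        using n by (simp add: \<delta>_def powr_diff)
      also have "\<dots> \<le> real n * dist x y"
        using F(4)[OF that] n by (intro mult_left_mono) auto
      also have "\<dots> = dist (real n *\<^sub>R x) (real n *\<^sub>R y)"
        by (simp add: dist_norm flip: scaleR_diff_right)
      finally have far: "real n powr e \<le> dist (real n *\<^sub>R x) (real n *\<^sub>R y)" .
      have "measure \<mu> (?X \<inter> ?Y) \<le> 7 / dist (real n *\<^sub>R x) (real n *\<^sub>R y)"
        using far D by (intro measure_hit_two) simp
      also have "\<dots> \<le> 7 / real n powr e"
        using far D by (intro divide_left_mono mult_pos_pos) linarith+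
      finally have m: "measure \<mu> (?X \<inter> ?Y) \<le> 7 / real n powr e" .
      \<comment> \<open>Independence would give the exponent -2t; the common lines add back t times
        their measure, at most 7t/n^e.\<close>
      have "measure \<mu> (?X \<union> ?Y) = 2 - measure \<mu> (?X \<inter> ?Y)"
        by (subst measure_Un3) (auto simp: measure_hit_1)
      then have "prob (U x \<inter> U y) = exp (- (t n * (2 - measure \<mu> (?X \<inter> ?Y))))"
        unfolding U_def missed_Un[symmetric] using t_pos by (subst prob_missed) auto
      also have "\<dots> = (exp (- t n))\<^sup>2 * exp (t n * measure \<mu> (?X \<inter> ?Y))"
        by (simp add: power2_eq_square algebra_simps flip: exp_add)
      also have "\<dots> \<le> (exp (- t n))\<^sup>2 * exp (t n * (7 / real n powr e))"
        using m t_pos by (intro mult_left_mono exp_le_cancel_iff[THEN iffD2]) auto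
      finally show ?thesis
        by (simp add: mult.commute)
    qed
    have "prob (?E n) \<le> prob {\<omega> \<in> space M. \<forall>x\<in>F. \<omega> \<notin> U x}"
    proof (rule finite_measure_mono)
      show "?E n \<subseteq> {\<omega> \<in> space M. \<forall>x\<in>F. \<omega> \<notin> U x}"
      proof safe
        fix \<omega> x assume \<omega>: "\<omega> \<in> space M" "x \<in> F" "\<omega> \<in> U x"
          and "cover_time (\<Psi> \<omega>) ((\<lambda>x. real n *\<^sub>R x) ` A) \<le> ereal (z + \<alpha> * ln (real n))"
        then have "covers (\<Psi> \<omega>) ((\<lambda>x. real n *\<^sub>R x) ` A) (t n)"
          by (rule_tac cover_time_leD) (auto simp: t_def z'_def)
        with \<omega> F(1) show False
          by (auto simp: covers_iff U_def)
      qed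
      have "{\<omega> \<in> space M. \<forall>x\<in>F. \<omega> \<notin> U x} = space M - (\<Union>x\<in>F. U x)"
        by auto
      then show "{\<omega> \<in> space M. \<forall>x\<in>F. \<omega> \<notin> U x} \<in> events"
        using F(2) by (auto simp: U_def)
    qed
    also have "\<dots> \<le> 1 / (real (card F) * exp (- t n)) + (exp (7 * (t n / real n powr e)) - 1)"
      using F N pU pair by (intro second_moment_none) (auto simp: U_def)
    also have "1 / (real (card F) * exp (- t n)) = exp (t n - ln (real N))"
      using N F(3) by (simp add: exp_diff exp_minus field_simps)
    also have "\<dots> \<le> exp (z' + l * ln 2 - \<eta> * ln (real n))"
      using lnN by (simp add: t_def \<eta>_def algebra_simps)
    finally show ?case
      by simp
  qed
  have "(\<lambda>n. z' * real n powr (- e) + \<alpha> * (ln (real n) / real n powr e)) \<longlonglongrightarrow> z' * 0 + \<alpha> * 0"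
    using e(1) by (intro tendsto_intros tendsto_neg_powr filterlim_real_sequentially lim_ln_over_power) auto
  moreover have "(\<lambda>n. z' * real n powr (- e) + \<alpha> * (ln (real n) / real n powr e)) = (\<lambda>n. t n / real n powr e)"
    by (simp add: t_def powr_minus field_simps add_divide_distrib fun_eq_iff)
  ultimately have "(\<lambda>n. t n / real n powr e) \<longlonglongrightarrow> 0"
    by simp
  then have "(\<lambda>n. exp (z' + l * ln 2 - \<eta> * ln (real n)) + (exp (7 * (t n / real n powr e)) - 1))
      \<longlonglongrightarrow> 0 + (exp (7 * 0) - 1)"
    using e(3) by (intro tendsto_intros tendsto_exp_ln_0) (auto simp: \<eta>_def)
  then have lim: "(\<lambda>n. exp (z' + l * ln 2 - \<eta> * ln (real n)) + (exp (7 * (t n / real n powr e)) - 1)) \<longlonglongrightarrow> 0"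
    by simp
  show ?thesis
    by (rule tendsto_sandwich[OF _ bound tendsto_const lim]) simp
qed

section \<open>Upper bound: above the upper box dimension\<close>

lemma prob_covered_tendsto_1:
  assumes A: "bounded A" "A \<noteq> {}" and \<alpha>: "upper_box_dim A < ereal \<alpha>"
  shows "(\<lambda>n. prob {\<omega> \<in> space M. cover_time (\<Psi> \<omega>) ((\<lambda>x. real n *\<^sub>R x) ` A) \<le> ereal (z + \<alpha> * ln (real n))})
    \<longlonglongrightarrow> 1" (is "(\<lambda>n. prob (?E n)) \<longlonglongrightarrow> 1")
proof -
  obtain u where u: "upper_box_dim A < ereal u" "u < \<alpha>"
    using ereal_dense2[OF \<alpha>] by auto
  have "\<forall>\<^sub>F \<delta> in at_right 0. ereal (ln (real (box_number \<delta> A)) / - ln \<delta>) < ereal u"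
    using u(1) unfolding upper_box_dim_def by (rule Limsup_lessD)
  moreover have "\<forall>\<^sub>F \<delta> in at_right 0. 0 < \<delta> \<and> \<delta> < (1::real)"
    by (rule eventually_at_rightI[of 0 1]) auto
  ultimately have ev0: "\<forall>\<^sub>F \<delta> in at_right 0. 0 < u \<and> ln (real (box_number \<delta> A)) < u * (- ln \<delta>)"
  proof eventually_elim
    case (elim \<delta>)
    then have ln\<delta>: "- ln \<delta> > 0"
      by simp
    \<comment> \<open>A nonempty set needs at least one box, so the quotients are nonnegative and
      their strict bound \<open>u\<close> is positive. This makes \<open>u / \<alpha>\<close> a
      legitimate target below 1.\<close>
    have "real (box_number \<delta> A) \<ge> 1"
      using box_number_pos[OF A, of \<delta>] elim by simp
    then have "ln (real (box_number \<delta> A)) / - ln \<delta> \<ge> 0"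
      using ln\<delta> by (intro divide_nonneg_pos) auto
    moreover have "ln (real (box_number \<delta> A)) / - ln \<delta> < u"
      using elim(1) by (simp only: less_ereal.simps)
    ultimately show ?case
      by (metis le_less_trans ln\<delta> pos_divide_less_eq)
  qed
  have "0 < u"
    using eventually_happens[OF ev0] by simp
  with u(2) have "u / \<alpha> < 1"
    by simp
  then obtain \<rho> where \<rho>: "0 < \<rho>" "\<rho> < 1" "measure \<mu> (hit 0 \<rho>) > u / \<alpha>"
    by (rule exists_hit_radius)
  define f where "f = measure \<mu> (hit 0 \<rho>)"
  define \<eta> where "\<eta> = \<alpha> * f - u"
  have \<eta>: "\<eta> > 0"
    using \<rho>(3) \<open>0 < u\<close> u(2) by (simp add: \<eta>_def f_def field_simps)
  \<comment> \<open>By the l1 bound on the norm, a cube of side \<open>\<epsilon>\<close> lies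
    within 1 - \<open>\<rho>\<close> of its corner.\<close>
  define \<epsilon> where "\<epsilon> = (1 - \<rho>) / CARD('d)"
  have \<epsilon>: "\<epsilon> > 0"
    using \<rho>(2) by (simp add: \<epsilon>_def)
  define t where "t n = z + \<alpha> * ln (real n)" for n
  have "filterlim (\<lambda>n. \<epsilon> / real n) (at_right 0) sequentially"
    unfolding filterlim_at
  proof
    show "\<forall>\<^sub>F n in sequentially. \<epsilon> / real n \<in> {0<..} \<and> \<epsilon> / real n \<noteq> 0"
      using eventually_gt_at_top[of 0] by eventually_elim (use \<epsilon> in simp)
    show "(\<lambda>n. \<epsilon> / real n) \<longlonglongrightarrow> 0"
      by (rule lim_const_over_n)
  qed
  with ev0 have "\<forall>\<^sub>F n in sequentially. 0 < u \<and>
      ln (real (box_number (\<epsilon> / real n) A)) < u * (- ln (\<epsilon> / real n))"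
    by (rule eventually_compose_filterlim)
  moreover have "\<forall>\<^sub>F n in sequentially. - z < \<alpha> * ln (real n)"
    using \<open>0 < u\<close> u(2) by (intro eventually_less_ln) simp
  moreover note eventually_gt_at_top[of 0]
  ultimately have bound: "\<forall>\<^sub>F n in sequentially.
      1 - exp (- u * ln \<epsilon> - z * f - \<eta> * ln (real n)) \<le> prob (?E n)"
  proof eventually_elim
    case (elim n)
    define N where "N = box_number (\<epsilon> / real n) A"
    have n: "n > 0" and t_pos: "0 < t n"
      using elim by (auto simp: t_def)
    have \<delta>: "\<epsilon> / real n > 0"
      using n \<epsilon> by simp
    have N: "N > 0"
      unfolding N_def by (rule box_number_pos[OF A \<delta>])
    obtain C where C: "finite C" "card C = N" "A \<subseteq> (\<Union>x\<in>C. cbox x (x + (\<chi> i. \<epsilon> / real n)))"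
      using box_number_cover[OF A(1) \<delta>] unfolding N_def by blast
    define U where "U x = missed (hit (real n *\<^sub>R x) \<rho>) (t n)" for x
    have U_sets: "U x \<in> events" for x
      by (simp add: U_def)
    have pU: "prob (U x) = exp (- (t n * f))" for x
    proof -
      have "measure \<mu> (hit (real n *\<^sub>R x) \<rho>) = f"
        using emeasure_hit_eq[of "real n *\<^sub>R x" \<rho>] by (simp add: f_def measure_def)
      then show ?thesis
        unfolding U_def using t_pos by (subst prob_missed) auto
    qed
    have cov: "covers (\<Psi> \<omega>) ((\<lambda>x. real n *\<^sub>R x) ` A) (t n)"
      if \<omega>: "\<omega> \<in> space M" "\<omega> \<notin> (\<Union>x\<in>C. U x)" for \<omega>
      unfolding covers_iff[OF \<omega>(1)]
    proof safe
      fix x assume x: "x \<in> A" "\<omega> \<in> missed (hit (real n *\<^sub>R x) 1) (t n)"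
      then obtain c where c: "c \<in> C" "x \<in> cbox c (c + (\<chi> i. \<epsilon> / real n))"
        using C(3) by blast
      have "norm (c - x) \<le> (\<Sum>i\<in>UNIV. \<bar>(c - x) $ i\<bar>)"
        by (rule norm_le_l1_cart)
      also have "\<dots> \<le> (\<Sum>i\<in>(UNIV :: 'd set). \<epsilon> / real n)"
      proof (rule sum_mono)
        fix i :: 'd
        have "c $ i \<le> x $ i \<and> x $ i \<le> c $ i + \<epsilon> / real n"
          using c(2) by (simp add: mem_box_cart)
        then show "\<bar>(c - x) $ i\<bar> \<le> \<epsilon> / real n"
          by simp
      qed
      also have "\<dots> = (1 - \<rho>) / real n"
        by (simp add: \<epsilon>_def)
      finally have "real n * norm (c - x) \<le> 1 - \<rho>"
        using n by (simp add: field_simps)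
      then have "dist (real n *\<^sub>R c) (real n *\<^sub>R x) \<le> 1 - \<rho>"
        by (simp add: dist_norm flip: scaleR_diff_right)
      from hit_shift[OF this, of \<rho>] have "hit (real n *\<^sub>R c) \<rho> \<subseteq> hit (real n *\<^sub>R x) 1"
        by simp
      then have "\<omega> \<in> U c"
        using x(2) unfolding U_def missed_def by blast
      with \<omega>(2) c(1) show False
        by blast
    qed
    \<comment> \<open>The union bound is of order n^(u - \<alpha> f) =
      n^(-\<open>\<eta>\<close>).\<close>
    have "prob (\<Union>x\<in>C. U x) \<le> (\<Sum>x\<in>C. prob (U x))"
      using C(1) U_sets by (intro finite_measure_subadditive_finite) auto
    also have "\<dots> = real N * exp (- (t n * f))"
      by (simp add: pU C(2))
    also have "\<dots> = exp (ln (real N) - t n * f)"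
      using N by (simp add: exp_diff exp_minus field_simps)
    also have "\<dots> \<le> exp (- u * ln \<epsilon> - z * f - \<eta> * ln (real n))"
    proof -
      have "ln (\<epsilon> / real n) = ln \<epsilon> - ln (real n)"
        using n \<epsilon> by (simp add: ln_div)
      then have "ln (real N) < u * (ln (real n) - ln \<epsilon>)"
        using elim(1) by (simp add: N_def)
      then show ?thesis
        by (simp add: t_def \<eta>_def algebra_simps)
    qed
    finally have "1 - exp (- u * ln \<epsilon> - z * f - \<eta> * ln (real n)) \<le> 1 - prob (\<Union>x\<in>C. U x)"
      by simp
    also have "\<dots> = prob (space M - (\<Union>x\<in>C. U x))"
      using C(1) U_sets by (intro prob_compl[symmetric]) auto
    also have "\<dots> \<le> prob (?E n)"
    proof (rule finite_measure_mono)
      show "?E n \<in> events"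
        using A(1) by (intro sets_cover_time bounded_scaling)
      show "space M - (\<Union>x\<in>C. U x) \<subseteq> ?E n"
        using cov cover_time_le[OF t_pos] by (auto simp: t_def)
    qed
    finally show ?case .
  qed
  have "(\<lambda>n. 1 - exp (- u * ln \<epsilon> - z * f - \<eta> * ln (real n))) \<longlonglongrightarrow> 1 - 0"
    using \<eta> by (intro tendsto_intros tendsto_exp_ln_0)
  then have lim: "(\<lambda>n. 1 - exp (- u * ln \<epsilon> - z * f - \<eta> * ln (real n))) \<longlonglongrightarrow> 1"
    by simp
  show ?thesis
    by (rule tendsto_sandwich[OF bound _ lim tendsto_const]) simp
qed

end

theorem theorem2p1:
  fixes A :: "(real^'d) set"
    and \<mu> :: "(real^'d) set measure"
    and M :: "'w measure"
    and \<Psi> :: "'w \<Rightarrow> ((real^'d) set \<times> real) set"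
  assumes "CARD('d) \<ge> 2"
    and "invariant_line_measure \<mu>"
    and "poisson_line_process M \<mu> \<Psi>"
    and "A \<noteq> {}" and "bounded A"
  shows "(\<forall>\<alpha> z :: real. ereal \<alpha> < lower_box_dim A \<longrightarrow>
            (\<lambda>n::nat. measure M {\<omega> \<in> space M.
               cover_time (\<Psi> \<omega>) ((\<lambda>x. real n *\<^sub>R x) ` A) - ereal (\<alpha> * ln (real n)) \<le> ereal z})
            \<longlonglongrightarrow> 0) \<and>
         (\<forall>\<alpha> z :: real. ereal \<alpha> > upper_box_dim A \<longrightarrow>
            (\<lambda>n::nat. measure M {\<omega> \<in> space M.
               cover_time (\<Psi> \<omega>) ((\<lambda>x. real n *\<^sub>R x) ` A) - ereal (\<alpha> * ln (real n)) \<le> ereal z})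
            \<longlonglongrightarrow> 1)"
proof -
  interpret prob_space M
    using assms(3) by (simp add: poisson_line_process_def poisson_point_process_def)
  interpret poisson_lines \<mu> M \<Psi>
    using assms(1-3) by unfold_locales
  show ?thesis
    using prob_covered_tendsto_0[OF assms(5,4)] prob_covered_tendsto_1[OF assms(5,4)]
    by (simp add: ereal_minus_le)
qed

end
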